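(* Let $N$ be an integer with $4\le N\le 10$. The equation $$\Delta_{\mathbb{S}^{N-1}}V+2(N-2)\bigl(e^{V}-1\bigr)=0\quad\text{on }\ \mathbb{S}^{N-1}$$ has countably infinitely many (i.e. a sequence of pairwise distinct) axially symmetric nonconstant classical solutions.
   Context: $\mathbb{S}^{N-1}$ is the unit sphere in $\mathbb{R}^N$ with its standard round metric and $\Delta_{\mathbb{S}^{N-1}}$ is its Laplace–Beltrami operator. A classical solution is a $C^2$ function on $\mathbb{S}^{N-1}$ satisfying the equation pointwise. A function on $\mathbb{S}^{N-1}$ is axially symmetric if it depends only on $\theta\in[0,\pi]$, the geodesic distance from the (fixed) north pole of $\mathbb{S}^{N-1}$. *)

theory Defs
  imports "HOL-Analysis.Analysis"
begin

definition C2_on :: "'a::euclidean_space set \<Rightarrow> ('a \<Rightarrow> real) \<Rightarrow> bool" where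
  "C2_on U f \<longleftrightarrow>
     (\<exists>(f' :: 'a \<Rightarrow> 'a \<Rightarrow>\<^sub>L real) (f'' :: 'a \<Rightarrow> 'a \<Rightarrow>\<^sub>L ('a \<Rightarrow>\<^sub>L real)).
        (\<forall>x\<in>U. (f has_derivative blinfun_apply (f' x)) (at x)) \<and>
        (\<forall>x\<in>U. (f' has_derivative blinfun_apply (f'' x)) (at x)) \<and>
        continuous_on U f'')"

text \<open>
  Functions and vector fields on the unit sphere are total functions on the ambient space;
  only their values on \<^term>\<open>sphere 0 1\<close> matter. The sphere being a closed embedded
  submanifold, a function on it is $C^2$ iff it extends to a $C^2$ function on a neighbourhood.
\<close>

definition C2_on_sphere :: "('a::euclidean_space \<Rightarrow> real) \<Rightarrow> bool" where
  "C2_on_sphere V \<longleftrightarrow>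
     (\<exists>U F. open U \<and> sphere 0 1 \<subseteq> U \<and> C2_on U F \<and> (\<forall>x\<in>sphere 0 1. F x = V x))"

text \<open>
  The round metric is the restriction of the ambient inner product to the tangent spaces
  $T_x = x^\perp$. A derivative at \<open>x\<close> within the sphere is determined only on $T_x$, so
  requiring the representing vector to be tangent makes the gradient unique.
\<close>

definition sphere_gradient :: "('a::euclidean_space \<Rightarrow> real) \<Rightarrow> 'a \<Rightarrow> 'a" where
  "sphere_gradient V x =
     (THE g. g \<bullet> x = 0 \<and> (V has_derivative (\<lambda>h. g \<bullet> h)) (at x within sphere 0 1))"

definition tangent_proj :: "'a::euclidean_space \<Rightarrow> 'a \<Rightarrow> 'a" where
  "tangent_proj x v = v - (v \<bullet> x) *\<^sub>R x"

text \<open>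
  The Levi-Civita connection of the induced metric is the tangential part of the ambient
  derivative. The argument \<open>v\<close> is meant to be tangent at \<open>x\<close>.
\<close>

definition sphere_covariant_derivative ::
    "('a::euclidean_space \<Rightarrow> 'a) \<Rightarrow> 'a \<Rightarrow> 'a \<Rightarrow> 'a" where
  "sphere_covariant_derivative X x v =
     tangent_proj x (frechet_derivative X (at x within sphere 0 1) v)"

text \<open>
  The divergence is the trace of the endomorphism $v \mapsto \nabla_v X$ of $T_x$. The trace
  is computed in the ambient orthonormal basis after precomposing with the projection onto $T_x$.
\<close>

definition sphere_divergence :: "('a::euclidean_space \<Rightarrow> 'a) \<Rightarrow> 'a \<Rightarrow> real" where
  "sphere_divergence X x =
     (\<Sum>b\<in>Basis. sphere_covariant_derivative X x (tangent_proj x b) \<bullet> b)"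

definition laplace_beltrami_sphere :: "('a::euclidean_space \<Rightarrow> real) \<Rightarrow> 'a \<Rightarrow> real" where
  "laplace_beltrami_sphere V x = sphere_divergence (sphere_gradient V) x"

definition sphere_geodesic_dist :: "'a::euclidean_space \<Rightarrow> 'a \<Rightarrow> real" where
  "sphere_geodesic_dist x y = arccos (x \<bullet> y)"

definition axially_symmetric :: "'a::euclidean_space \<Rightarrow> ('a \<Rightarrow> real) \<Rightarrow> bool" where
  "axially_symmetric p V \<longleftrightarrow>
     (\<exists>u :: real \<Rightarrow> real. \<forall>x\<in>sphere 0 1. V x = u (sphere_geodesic_dist p x))"

definition classical_solution :: "(real ^ 'n \<Rightarrow> real) \<Rightarrow> bool" where
  "classical_solution V \<longleftrightarrow>
     C2_on_sphere V \<and>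
     (\<forall>x\<in>sphere 0 1.
        laplace_beltrami_sphere V x + 2 * (real CARD('n) - 2) * (exp (V x) - 1) = 0)"


end

theory Submission
  imports Defs
begin

text \<open>
  In the coordinate \<open>t\<close> with \<open>tanh t = cos \<theta>\<close>, subtracting the explicit singular solution
  \<open>ln (m / (m + 1)) - 2 * ln (sin \<theta>)\<close>, \<open>m = N - 3\<close>, turns the axially symmetric equation into the
  anti-damped oscillator \<open>w'' = m * tanh t * w' - 2 * m * (exp w - 1)\<close>. We shoot from the equator with
  \<open>w 0 = a > 0\<close> and \<open>w' 0 = 0\<close>. Since \<open>m < 8\<close>, the linearization at \<open>w = 0\<close> is a spiral, so that
  orbits with small \<open>a\<close> wind around the origin of the phase plane arbitrarily often. An orbit either
  eventually drops below a barrier \<open>w' = - 2 - o(1)\<close> and then falls forever, or it satisfies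
  \<open>w' \<longlonglongrightarrow> - 2\<close> and yields a solution regular at the poles. The winding number of the falling
  orbits is locally constant in \<open>a\<close> but unbounded as \<open>a\<close> tends to \<open>0\<close>, so every interval \<open>(0, \<epsilon>)\<close>
  contains an \<open>a\<close> with a regular orbit.
\<close>

text \<open>The limiting linearization \<open>w'' = m * w' - 2 * m * w\<close> has discriminant
  \<open>m\<^sup>2 - 8 * m\<close>, negative for the admissible values 1, ..., 7 of
  \<open>m\<close>. The anti-damping drives generic orbits away, so an orbit regular at the pole is
  exceptional, and there is no evident scalar shooting function with a sign change. What can be
  counted is the turn on which an orbit falls: crossing the barrier is an open condition that is
  never undone, so this integer depends continuously on \<open>a\<close>. The slope -2 is forced by
  regularity, because the singular solution grows like \<open>2 * t\<close> at the pole and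
  \<open>w\<close> has to cancel it. The start \<open>w' 0 = 0\<close> makes the solution even about
  the equator, so one pole takes care of the other. Truncating the exponential gives orbits for all
  time; an energy bound shows afterwards that orbits above the barrier never see the truncation.
  Distinctness is read off at the equator, where the solution equals
  \<open>a + ln (m / (m + 1))\<close>. The solution is built as a C2 function of cos theta on the
  whole real line, hence it extends to the ambient space and the poles need no charts.\<close>

section \<open>The Laplacian of axially symmetric functions\<close>

text \<open>The great circle through \<open>x\<close> in the direction of \<open>v\<close> stays in
  the sphere, so composing with it reduces the claim to uniqueness of derivatives on the real
  line.\<close>

lemma has_derivative_within_sphere_unique:
  fixes f :: "'a::euclidean_space \<Rightarrow> 'b::real_normed_vector"
  assumes f1: "(f has_derivative D1) (at x within sphere 0 1)"
    and f2: "(f has_derivative D2) (at x within sphere 0 1)"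
    and x: "x \<in> sphere 0 1" and v: "v \<bullet> x = 0"
  shows "D1 v = D2 v"
proof (cases "v = 0")
  case True
  then show ?thesis
    using has_derivative_linear[OF f1] has_derivative_linear[OF f2] by (simp add: linear_0)
next
  case False
  define u where "u = v /\<^sub>R norm v"
  have nx: "x \<bullet> x = 1" and nu: "u \<bullet> u = 1" and ux: "u \<bullet> x = 0" "x \<bullet> u = 0"
    using x v False
    by (auto simp: u_def dot_square_norm power2_eq_square inner_commute)
  define c where "c t = cos t *\<^sub>R x + sin t *\<^sub>R u" for t :: real
  have c_sphere: "c t \<in> sphere 0 1" for t
  proof -
    have "(norm (c t))\<^sup>2 = (cos t)\<^sup>2 + (sin t)\<^sup>2"
      unfolding power2_norm_eq_inner c_def
      by (simp add: inner_add_left inner_add_right nx nu ux power2_eq_square)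
    then show ?thesis using norm_ge_zero[of "c t"] by (auto simp: power2_eq_1_iff simp del: norm_ge_zero)
  qed
  have c': "(c has_derivative (\<lambda>t. t *\<^sub>R u)) (at 0)"
    unfolding c_def by (auto intro!: derivative_eq_intros)
  have c0: "c 0 = x" by (simp add: c_def)
  have "(f has_derivative D) (at (c 0) within sphere 0 1) \<Longrightarrow>
      ((\<lambda>t. f (c t)) has_derivative (\<lambda>t. D (t *\<^sub>R u))) (at 0)" for D
    by (rule has_derivative_in_compose[OF c'])
      (use c_sphere in \<open>auto intro: has_derivative_subset\<close>)
  then have "(\<lambda>t. D1 (t *\<^sub>R u)) = (\<lambda>t. D2 (t *\<^sub>R u))"
    using f1 f2 has_derivative_unique unfolding c0 by blast
  then have "D1 (norm v *\<^sub>R u) = D2 (norm v *\<^sub>R u)"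
    by (rule fun_cong)
  then show ?thesis using False by (simp add: u_def)
qed

lemma sphere_gradient_eqI:
  assumes "g \<bullet> x = 0" "x \<in> sphere 0 1"
    and "(V has_derivative (\<lambda>h. g \<bullet> h)) (at x within sphere 0 1)"
  shows "sphere_gradient V x = g"
  unfolding sphere_gradient_def
proof (rule the_equality)
  show "g \<bullet> x = 0 \<and> (V has_derivative (\<lambda>h. g \<bullet> h)) (at x within sphere 0 1)"
    using assms by simp
next
  fix k assume k: "k \<bullet> x = 0 \<and> (V has_derivative (\<lambda>h. k \<bullet> h)) (at x within sphere 0 1)"
  have "g \<bullet> (k - g) = k \<bullet> (k - g)"
    by (rule has_derivative_within_sphere_unique[OF assms(3) _ assms(2)])
      (use k assms(1) in \<open>auto simp: inner_diff_left\<close>)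
  then have "(k - g) \<bullet> (k - g) = 0" by (simp add: inner_diff_left)
  then show "k = g" by simp
qed

lemma axial_has_derivative:
  assumes "(G has_real_derivative G') (at (x \<bullet> p))"
  shows "((\<lambda>x. G (x \<bullet> p)) has_derivative (\<lambda>h. G' * (h \<bullet> p))) (at x)"
proof -
  have "((\<lambda>x. x \<bullet> p) has_derivative (\<lambda>h. h \<bullet> p)) (at x)"
    by (auto intro!: derivative_eq_intros)
  from has_derivative_compose[OF this, of G "(*) G'"] show ?thesis
    using assms by (simp add: has_field_derivative_def)
qed

lemma sphere_gradient_axial:
  assumes "(G has_real_derivative G') (at (x \<bullet> p))" and "x \<in> sphere 0 1"
  shows "sphere_gradient (\<lambda>x. G (x \<bullet> p)) x = G' *\<^sub>R tangent_proj x p"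
proof (rule sphere_gradient_eqI)
  have nx: "x \<bullet> x = 1" using assms(2) by (simp add: dot_square_norm)
  show "G' *\<^sub>R tangent_proj x p \<bullet> x = 0"
    by (simp add: tangent_proj_def inner_diff_left inner_diff_right nx inner_commute)
  have tangent: "((\<lambda>y. y \<bullet> y) has_derivative (\<lambda>h. 2 * (h \<bullet> x))) (at x within sphere 0 1)"
    by (auto intro!: derivative_eq_intros simp: inner_commute)
  \<comment> \<open>The ambient gradient \<open>G' * p\<close> is not tangent. Subtracting a
    multiple of \<open>y \<bullet> y\<close>, which is constant on the sphere, removes its normal
    component without changing the function there.\<close>
  have "((\<lambda>y. G (y \<bullet> p) - G' * (x \<bullet> p) / 2 * (y \<bullet> y)) has_derivative
      (\<lambda>h. G' * (h \<bullet> p) - G' * (x \<bullet> p) / 2 * (2 * (h \<bullet> x)))) (at x within sphere 0 1)"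
    by (intro has_derivative_diff has_derivative_mult_right
        has_derivative_at_withinI[OF axial_has_derivative] assms(1) tangent)
  then have "((\<lambda>y. G (y \<bullet> p) - G' * (x \<bullet> p) / 2) has_derivative
      (\<lambda>h. G' * (h \<bullet> p) - G' * (x \<bullet> p) / 2 * (2 * (h \<bullet> x)))) (at x within sphere 0 1)"
    by (rule has_derivative_transform[rotated 2]) (use assms(2) in \<open>auto simp: dot_square_norm\<close>)
  from has_derivative_add[OF this has_derivative_const[of "G' * (x \<bullet> p) / 2"]]
  show "((\<lambda>x. G (x \<bullet> p)) has_derivative (\<bullet>) (G' *\<^sub>R tangent_proj x p)) (at x within sphere 0 1)"
    by (auto simp: tangent_proj_def inner_diff_left inner_commute algebra_simps
        elim!: has_derivative_eq_rhs)
qed (use assms in simp)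

text \<open>On tangent vectors the Hessian is \<open>G2 z\<close> times the square of the form given
  by \<open>t\<close>, the tangential part of \<open>p\<close>, minus \<open>G1 z * z\<close> times
  the identity. Its trace over the tangent space uses \<open>t \<bullet> t = 1 - z\<^sup>2\<close>
  and the dimension \<open>DIM('a) - 1\<close>.\<close>

lemma laplace_beltrami_sphere_axial:
  fixes p x :: "'a::euclidean_space"
  assumes p: "p \<in> sphere 0 1" and x: "x \<in> sphere 0 1"
    and G: "\<And>z. (G has_real_derivative G1 z) (at z)"
    and G1: "\<And>z. (G1 has_real_derivative G2 z) (at z)"
  shows "laplace_beltrami_sphere (\<lambda>x. G (x \<bullet> p)) x =
    (1 - (x \<bullet> p)\<^sup>2) * G2 (x \<bullet> p) - (DIM('a) - 1) * (x \<bullet> p) * G1 (x \<bullet> p)"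
proof -
  have nx: "x \<bullet> x = 1" and np: "p \<bullet> p = 1" using x p by (auto simp: dot_square_norm)
  define z where "z = x \<bullet> p"
  define t where "t = p - z *\<^sub>R x"
  have tx: "t \<bullet> x = 0" by (simp add: t_def inner_diff_left inner_diff_right nx z_def inner_commute)
  define X where "X y = G1 (y \<bullet> p) *\<^sub>R tangent_proj y p" for y
  define D where "D h = G1 z *\<^sub>R - ((p \<bullet> h) *\<^sub>R x + z *\<^sub>R h) + (G2 z * (h \<bullet> p)) *\<^sub>R t" for h
  have "(X has_derivative D) (at x within sphere 0 1)"
    unfolding X_def tangent_proj_def D_def t_def z_def
    by (auto intro!: derivative_eq_intros has_derivative_at_withinI[OF axial_has_derivative] G1
        simp: inner_commute algebra_simps)
  then have X': "(sphere_gradient (\<lambda>x. G (x \<bullet> p)) has_derivative D) (at x within sphere 0 1)"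
    by (rule has_derivative_transform[OF x, rotated])
      (simp add: X_def sphere_gradient_axial[OF G])
  have cov: "sphere_covariant_derivative (sphere_gradient (\<lambda>x. G (x \<bullet> p))) x v =
      (G2 z * (v \<bullet> t)) *\<^sub>R t - (G1 z * z) *\<^sub>R v" if v: "v \<bullet> x = 0" for v
  proof -
    \<comment> \<open>\<open>frechet_derivative\<close> within the sphere is a choice among several
      linear maps; they agree on tangent vectors, which is why \<open>cov\<close> is restricted to
      those.\<close>
    have fd: "frechet_derivative (sphere_gradient (\<lambda>x. G (x \<bullet> p))) (at x within sphere 0 1) v = D v"
      by (rule has_derivative_within_sphere_unique[OF _ X' x v])
        (use X' in \<open>auto simp: frechet_derivative_works[symmetric] differentiable_def\<close>)
    have Dx: "D v \<bullet> x = - (G1 z * (p \<bullet> v))"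
      unfolding D_def by (simp add: inner_add_left inner_diff_left tx nx v)
    have vt: "v \<bullet> t = v \<bullet> p"
      by (simp add: t_def inner_diff_right v)
    show ?thesis
      unfolding sphere_covariant_derivative_def tangent_proj_def fd Dx vt
      by (simp add: D_def algebra_simps)
  qed
  have tp: "tangent_proj x b \<bullet> x = 0" for b
    by (simp add: tangent_proj_def inner_diff_left inner_diff_right nx inner_commute)
  have tpt: "tangent_proj x b \<bullet> t = t \<bullet> b" for b
    using tx by (simp add: tangent_proj_def inner_diff_left inner_diff_right inner_commute)
  have tpb: "tangent_proj x b \<bullet> b = 1 - (x \<bullet> b) * (x \<bullet> b)" if "b \<in> Basis" for b
    using that by (simp add: tangent_proj_def inner_diff_left inner_diff_right inner_commute)
  have tt: "t \<bullet> t = 1 - z\<^sup>2"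
    by (simp add: t_def inner_diff_left inner_diff_right nx np z_def inner_commute power2_eq_square)
  have "laplace_beltrami_sphere (\<lambda>x. G (x \<bullet> p)) x =
     (\<Sum>b\<in>Basis. G2 z * ((t \<bullet> b) * (t \<bullet> b)) - G1 z * z * (1 - (x \<bullet> b) * (x \<bullet> b)))"
    unfolding laplace_beltrami_sphere_def sphere_divergence_def
    by (rule sum.cong) (simp_all add: cov[OF tp] tpt inner_diff_left tpb)
  also have "\<dots> = G2 z * (t \<bullet> t) - G1 z * z * (DIM('a) - x \<bullet> x)"
    by (simp add: sum_subtractf sum_distrib_left[symmetric] euclidean_inner[symmetric])
  finally show ?thesis by (simp add: tt nx z_def algebra_simps)
qed

lemma C2_on_axial:
  fixes p :: "'a::euclidean_space"
  assumes G: "\<And>z. (G has_real_derivative G1 z) (at z)"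
    and G1: "\<And>z. (G1 has_real_derivative G2 z) (at z)" and G2: "continuous_on UNIV G2"
  shows "C2_on UNIV (\<lambda>x. G (x \<bullet> p))"
proof -
  define b where "b = blinfun_inner_left p"
  define B where "B = blinfun_scaleR_left b o\<^sub>L b"
  have b: "blinfun_apply b h = h \<bullet> p" for h by (simp add: b_def inner_commute)
  have B: "blinfun_apply B h = (h \<bullet> p) *\<^sub>R b" for h by (simp add: B_def b)
  have d1: "((\<lambda>x. G (x \<bullet> p)) has_derivative blinfun_apply (G1 (x \<bullet> p) *\<^sub>R b)) (at x)" for x
  proof -
    have "blinfun_apply (G1 (x \<bullet> p) *\<^sub>R b) = (\<lambda>h. G1 (x \<bullet> p) * (h \<bullet> p))"
      by (auto simp: blinfun.scaleR_left b)
    then show ?thesis using axial_has_derivative[OF G, where x = x and p = p] by simp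
  qed
  have d2: "((\<lambda>x. G1 (x \<bullet> p) *\<^sub>R b) has_derivative blinfun_apply (G2 (x \<bullet> p) *\<^sub>R B)) (at x)" for x
  proof -
    have "blinfun_apply (G2 (x \<bullet> p) *\<^sub>R B) = (\<lambda>h. (G2 (x \<bullet> p) * (h \<bullet> p)) *\<^sub>R b)"
      by (auto simp: blinfun.scaleR_left B)
    then show ?thesis
      using has_derivative_scaleR_left[OF axial_has_derivative[OF G1, where x = x and p = p], of b]
      by simp
  qed
  have "continuous_on UNIV (\<lambda>x. G2 (x \<bullet> p) *\<^sub>R B)"
    by (intro continuous_intros continuous_on_compose2[OF G2]) auto
  with d1 d2 show ?thesis
    unfolding C2_on_def
    by (intro exI[of _ "\<lambda>x. G1 (x \<bullet> p) *\<^sub>R b"] exI[of _ "\<lambda>x. G2 (x \<bullet> p) *\<^sub>R B"]) simp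
qed

section \<open>Initial value problems\<close>

text \<open>A global Lipschitz constant and an exponentially weighted norm make a single fixed point
  yield the solution for all positive times, with no continuation argument.\<close>

lemma global_lipschitz_ivp_exists:
  fixes f :: "real \<Rightarrow> 'a::euclidean_space \<Rightarrow> 'a"
  assumes cont: "continuous_on UNIV (\<lambda>(t, x). f t x)" and L: "L > 0"
    and lip: "\<And>t x y. norm (f t x - f t y) \<le> L * norm (x - y)"
    and zero: "\<And>t. f t 0 = 0"
  shows "\<exists>x. x 0 = x0 \<and> continuous_on {0..} x \<and>
    (\<forall>t>0. (x has_vector_derivative f t (x t)) (at t))"
proof -
  \<comment> \<open>Twice the Lipschitz constant gives the contraction ratio 1/2. The unknown below
    is \<open>y s = exp (- K * s) *\<^sub>R x s\<close>, so that the weighted norm of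
    \<open>x\<close> becomes the ordinary supremum norm of \<open>y\<close>.\<close>
  define K where "K = 2 * L"
  have K: "K > 0" using L by (simp add: K_def)
  define g where "g y s = f s (exp (K * s) *\<^sub>R y s)" for y and s :: real
  \<comment> \<open>The Picard operator is a contraction of ratio \<open>L / K\<close> for the norm weighted by \<open>exp (- K * t)\<close>.\<close>
  define T where "T y t = exp (- K * max 0 t) *\<^sub>R (x0 + integral {0..max 0 t} (g y))" for y t
  have g_cont: "continuous_on A (g y)" if "continuous_on A y" for A y
  proof -
    have "continuous_on A (\<lambda>s. (\<lambda>(t, x). f t x) (s, exp (K * s) *\<^sub>R y s))"
      by (rule continuous_on_compose2[OF cont]) (auto intro!: continuous_intros that)
    then show ?thesis by (simp add: g_def)
  qed
  have exp_int: "((\<lambda>s. B * exp (K * s)) has_integral (B / K * exp (K * t) - B / K)) {0..t}"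
    if "t \<ge> 0" for t B :: real
  proof -
    have "((\<lambda>s. B * exp (K * s)) has_integral (B / K * exp (K * t) - B / K * exp (K * 0))) {0..t}"
      by (rule fundamental_theorem_of_calculus[OF that])
        (use K in \<open>auto intro!: derivative_eq_intros
          simp: has_real_derivative_iff_has_vector_derivative[symmetric]\<close>)
    then show ?thesis by simp
  qed
  have int_bound: "norm (integral {0..t} (\<lambda>s. g y s - g z s)) \<le> B * L / K * exp (K * t)"
    if y: "continuous_on UNIV y" and z: "continuous_on UNIV z" and t: "t \<ge> 0"
      and B: "\<And>s. norm (y s - z s) \<le> B" for y z t B
  proof -
    have B0: "B \<ge> 0" using norm_ge_zero B[of 0] by (rule order_trans)
    have "norm (integral {0..t} (\<lambda>s. g y s - g z s)) \<le> integral {0..t} (\<lambda>s. B * L * exp (K * s))"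
    proof (rule integral_norm_bound_integral)
      show "(\<lambda>s. g y s - g z s) integrable_on {0..t}"
        by (intro integrable_continuous_interval continuous_intros g_cont
            continuous_on_subset[OF y] continuous_on_subset[OF z]) auto
      show "(\<lambda>s. B * L * exp (K * s)) integrable_on {0..t}"
        using exp_int[OF t] by blast
      fix s
      have "norm (g y s - g z s) \<le> L * norm (exp (K * s) *\<^sub>R (y s - z s))"
        unfolding g_def scaleR_right_diff_distrib by (rule lip)
      also have "\<dots> \<le> L * (exp (K * s) * B)"
        using B[of s] L by simp
      finally show "norm (g y s - g z s) \<le> B * L * exp (K * s)" by (simp add: mult_ac)
    qed
    also have "\<dots> \<le> B * L / K * exp (K * t)"
      using integral_unique[OF exp_int[OF t, of "B * L"]] B0 L K by simp
    finally show ?thesis .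
  qed
  have T_diff: "norm (T y t - T z t) \<le> 1/2 * B"
    if y: "continuous_on UNIV y" and z: "continuous_on UNIV z"
      and B: "\<And>s. norm (y s - z s) \<le> B" for y z t B
  proof -
    define r where "r = max 0 t"
    have r: "r \<ge> 0" by (simp add: r_def)
    have "integral {0..r} (g y) - integral {0..r} (g z) = integral {0..r} (\<lambda>s. g y s - g z s)"
      by (rule integral_diff[symmetric])
        (intro integrable_continuous_interval g_cont continuous_on_subset[OF y]
          continuous_on_subset[OF z] subset_UNIV)+
    then have "T y t - T z t = exp (- K * r) *\<^sub>R integral {0..r} (\<lambda>s. g y s - g z s)"
      unfolding T_def r_def[symmetric]
      by (simp add: scaleR_right_diff_distrib[symmetric])
    then have "norm (T y t - T z t) \<le> exp (- K * r) * (B * L / K * exp (K * r))"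
      using mult_left_mono[OF int_bound[OF y z r B], of "exp (- K * r)"] by simp
    also have "\<dots> = B * L / K" by (simp add: exp_minus field_simps)
    also have "\<dots> = 1/2 * B" using L by (simp add: K_def)
    finally show ?thesis .
  qed
  have T_zero: "T (\<lambda>_. 0) t = exp (- K * max 0 t) *\<^sub>R x0" for t
    by (simp add: T_def g_def[abs_def] zero)
  have int_cont: "continuous_on {0..} (\<lambda>r. integral {0..r} (g y))"
    if y: "continuous_on UNIV y" for y
    unfolding continuous_on_eq_continuous_within
  proof
    fix r :: real assume "r \<in> {0..}"
    have "continuous_on {0..r+1} (\<lambda>r. integral {0..r} (g y))"
      by (intro indefinite_integral_continuous_1 integrable_continuous_interval g_cont
          continuous_on_subset[OF y] subset_UNIV)
    then have "continuous (at r within {0..r+1}) (\<lambda>r. integral {0..r} (g y))"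
      using \<open>r \<in> {0..}\<close> by (simp add: continuous_on_eq_continuous_within)
    moreover have "at r within {0..r+1} = at r within {0..}"
      by (rule at_within_nhd[of _ "{..<r+1}"]) auto
    ultimately show "continuous (at r within {0..}) (\<lambda>r. integral {0..r} (g y))" by simp
  qed
  have T_cont: "continuous_on UNIV (T y)" if y: "continuous_on UNIV y" for y
    unfolding T_def
    by (intro continuous_intros continuous_on_compose2[OF int_cont[OF y]]) auto
  \<comment> \<open>Boundedness of \<open>T y\<close> comes from comparison with \<open>T 0\<close>,
    which is bounded since \<open>f\<close> vanishes at 0. The \<open>max 0 t\<close> in
    \<open>T\<close> extends everything constantly to negative times, as bounded continuous
    functions live on the whole line.\<close>
  have T_bcontfun: "T (apply_bcontfun y) \<in> bcontfun" for y :: "real \<Rightarrow>\<^sub>C 'a"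
  proof -
    obtain B where B: "\<And>s. norm (y s) \<le> B"
      using bounded_apply_bcontfun[of y] by (auto simp: bounded_iff)
    have "norm (T y t) \<le> 1/2 * B + norm x0" for t
    proof -
      have "norm (T y t - T (\<lambda>_. 0) t) \<le> 1/2 * B"
        by (rule T_diff) (use B in auto)
      moreover have "norm (T (\<lambda>_. 0) t) \<le> norm x0"
        unfolding T_zero using K by (simp add: mult_left_le_one_le)
      ultimately show ?thesis using norm_triangle_sub[of "T y t" "T (\<lambda>_. 0) t"] by linarith
    qed
    then show ?thesis
      unfolding bcontfun_def using T_cont[of y] by (auto simp: bounded_iff)
  qed
  define \<T> where "\<T> y = Bcontfun (T (apply_bcontfun y))" for y
  have \<T>: "apply_bcontfun (\<T> y) = T (apply_bcontfun y)" for y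
    unfolding \<T>_def by (rule Bcontfun_inverse[OF T_bcontfun])
  have "\<exists>!y. \<T> y = y"
  proof (rule banach_fix_type[of "1/2"])
    show "\<forall>y z. dist (\<T> y) (\<T> z) \<le> 1/2 * dist y z"
    proof (intro allI dist_bound)
      fix y z :: "real \<Rightarrow>\<^sub>C 'a" and t
      show "dist (\<T> y t) (\<T> z t) \<le> 1/2 * dist y z"
        unfolding \<T> dist_norm[of "T _ _"]
        by (rule T_diff) (auto simp: dist_norm[symmetric] intro: dist_bounded)
    qed
  qed auto
  then obtain y where "\<T> y = y" by blast
  then have y: "apply_bcontfun y t = T (apply_bcontfun y) t" for t
    using \<T>[of y] by simp
  define x where "x t = exp (K * t) *\<^sub>R y t" for t
  have x_eq: "x t = x0 + integral {0..t} (\<lambda>s. f s (x s))" if "t \<ge> 0" for t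
  proof -
    have "x t = (exp (K * t) * exp (- K * t)) *\<^sub>R (x0 + integral {0..t} (g y))"
      using that unfolding x_def by (subst y) (simp add: T_def)
    also have "exp (K * t) * exp (- K * t) = 1" by (simp add: exp_minus)
    finally show ?thesis by (simp add: g_def[abs_def] x_def)
  qed
  have x_cont: "continuous_on UNIV x"
    unfolding x_def by (intro continuous_intros) auto
  have fx_cont: "continuous_on A (\<lambda>s. f s (x s))" for A
    using g_cont[of A y] by (simp add: g_def[abs_def] x_def)
  have "(x has_vector_derivative f t (x t)) (at t)" if "t > 0" for t
  proof -
    have "((\<lambda>u. integral {0..u} (\<lambda>s. f s (x s))) has_vector_derivative f t (x t))
        (at t within {0..t+1})"
      by (rule integral_has_vector_derivative[OF fx_cont]) (use that in auto)
    then have "((\<lambda>u. integral {0..u} (\<lambda>s. f s (x s))) has_vector_derivative f t (x t)) (at t)"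
      using that by (subst (asm) at_within_interior) auto
    then have "((\<lambda>u. x0 + integral {0..u} (\<lambda>s. f s (x s))) has_vector_derivative f t (x t)) (at t)"
      by (auto intro!: derivative_eq_intros)
    then show ?thesis
      by (rule has_vector_derivative_transform_within_open[of _ _ _ "{0<..}"])
        (use that x_eq in auto)
  qed
  moreover have "x 0 = x0" using x_eq[of 0] by simp
  ultimately show ?thesis using x_cont continuous_on_subset by blast
qed

text \<open>At the last time at which \<open>u\<close> is at most \<open>c\<close>, continuity
  forces equality, and the negative slope produces a later such time.\<close>

lemma downward_barrier:
  fixes u :: "real \<Rightarrow> real"
  assumes cont: "continuous_on {s0..s} u" and start: "u s0 \<le> c"
    and down: "\<And>r. s0 \<le> r \<Longrightarrow> r < s \<Longrightarrow> u r = c \<Longrightarrow> \<exists>d<0. (u has_real_derivative d) (at r)"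
    and s: "s0 \<le> s"
  shows "u s \<le> c"
proof (rule ccontr)
  assume "\<not> u s \<le> c"
  define A where "A = {s0..s} \<inter> u -` {..c}"
  have "closed A"
    unfolding A_def
    by (rule continuous_closed_preimage) (auto intro: continuous_on_subset[OF cont])
  moreover have "s0 \<in> A" "bdd_above A" using start s by (auto simp: A_def)
  ultimately have "Sup A \<in> A" by (intro closed_contains_Sup) auto
  define r where "r = Sup A"
  have r: "s0 \<le> r" "r \<le> s" "u r \<le> c" using \<open>Sup A \<in> A\<close> by (auto simp: r_def A_def)
  have above: "u t > c" if "r < t" "t \<le> s" for t
  proof (rule ccontr)
    assume "\<not> u t > c"
    then have "t \<in> A" using that r by (auto simp: A_def)
    then show False using cSup_upper[OF \<open>t \<in> A\<close> \<open>bdd_above A\<close>] that by (simp add: r_def)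
  qed
  have "r < s" using r \<open>\<not> u s \<le> c\<close> by (cases "r = s") auto
  have "u r = c"
  proof (rule ccontr)
    assume "u r \<noteq> c"
    then have "\<exists>t. r \<le> t \<and> t \<le> s \<and> u t = c"
      using r \<open>\<not> u s \<le> c\<close> \<open>r < s\<close>
      by (intro IVT' continuous_on_subset[OF cont]) auto
    then obtain t where "r \<le> t" "t \<le> s" "u t = c" by blast
    with \<open>u r \<noteq> c\<close> above[of t] show False by (cases "r = t") auto
  qed
  then obtain d where "d < 0" "(u has_real_derivative d) (at r)"
    using down r \<open>r < s\<close> by blast
  then obtain e where "e > 0" and e: "\<And>h. 0 < h \<Longrightarrow> h < e \<Longrightarrow> u (r + h) < u r"
    using DERIV_neg_dec_right by blast
  define h where "h = min (e / 2) (s - r)"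
  have "0 < h" "h < e" "r + h \<le> s" using \<open>e > 0\<close> \<open>r < s\<close> by (auto simp: h_def)
  then show False using e[of h] above[of "r + h"] \<open>u r = c\<close> by simp
qed

text \<open>A positive value stays positive, so \<open>u t * exp (- \<gamma> * t)\<close> is
  nondecreasing from then on and cannot tend to 0. This selects the exceptional non-growing
  solutions of unstable equations.\<close>

lemma unstable_bound:
  fixes u :: "real \<Rightarrow> real"
  assumes "\<gamma> > 0"
    and deriv: "\<And>t. t > S \<Longrightarrow> (u has_real_derivative u' t) (at t)"
    and grow: "\<And>t. t > S \<Longrightarrow> u t > 0 \<Longrightarrow> u' t \<ge> \<gamma> * u t"
    and lim: "((\<lambda>t. u t * exp (- \<gamma> * t)) \<longlongrightarrow> 0) at_top"
    and t: "t > S"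
  shows "u t \<le> 0"
proof (rule ccontr)
  assume "\<not> u t \<le> 0"
  have cont: "continuous_on {t..} u"
    by (rule DERIV_continuous_on[of _ _ u'])
      (use t in \<open>auto intro: has_field_derivative_at_within[OF deriv]\<close>)
  have pos: "u s > 0" if "s \<ge> t" for s
  proof -
    have "- u s \<le> - (u t / 2)"
    proof (rule downward_barrier[OF _ _ _ that])
      show "continuous_on {t..s} (\<lambda>s. - u s)"
        by (intro continuous_intros continuous_on_subset[OF cont]) auto
      fix r assume r: "t \<le> r" "- u r = - (u t / 2)"
      have "((\<lambda>s. - u s) has_real_derivative - u' r) (at r)"
        using deriv[of r] t r by (auto intro!: derivative_eq_intros)
      moreover have "u' r \<ge> \<gamma> * u r" "u r > 0"
        using grow[of r] t r \<open>\<not> u t \<le> 0\<close> by auto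
      then have "u' r > 0" using \<open>\<gamma> > 0\<close> by (smt (verit) mult_pos_pos)
      ultimately show "\<exists>d<0. ((\<lambda>s. - u s) has_real_derivative d) (at r)"
        by (intro exI[of _ "- u' r"]) auto
    qed (use \<open>\<not> u t \<le> 0\<close> in auto)
    then show ?thesis using \<open>\<not> u t \<le> 0\<close> by simp
  qed
  have "u t * exp (- \<gamma> * t) \<le> u s * exp (- \<gamma> * s)" if "s \<ge> t" for s
  proof (rule DERIV_nonneg_imp_nondecreasing[OF that])
    fix r assume r: "t \<le> r" "r \<le> s"
    have "((\<lambda>s. u s * exp (- \<gamma> * s)) has_real_derivative
        (u' r - \<gamma> * u r) * exp (- \<gamma> * r)) (at r)"
      using deriv[of r] t r by (auto intro!: derivative_eq_intros simp: algebra_simps)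
    moreover have "(u' r - \<gamma> * u r) * exp (- \<gamma> * r) \<ge> 0"
      using grow[of r] pos[of r] t r by simp
    ultimately show "\<exists>y. ((\<lambda>s. u s * exp (- \<gamma> * s)) has_real_derivative y) (at r) \<and> 0 \<le> y"
      by blast
  qed
  then have "\<forall>\<^sub>F s in at_top. u t * exp (- \<gamma> * t) \<le> u s * exp (- \<gamma> * s)"
    by (auto simp: eventually_at_top_linorder)
  then have "u t * exp (- \<gamma> * t) \<le> 0"
    using lim by (intro tendsto_lowerbound[OF lim]) auto
  then show False using \<open>\<not> u t \<le> 0\<close> by (simp add: mult_le_0_iff)
qed

text \<open>The equation repels from its moving equilibrium, which tends to \<open>- l / c\<close>.
  A solution growing more slowly than \<open>exp (\<gamma> * t)\<close> must follow it:
  \<open>unstable_bound\<close> is applied to the excess above and below this value, with a margin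
  \<open>e1\<close>.\<close>

lemma unstable_limit:
  fixes y f :: "real \<Rightarrow> real"
  assumes c: "0 < \<gamma>" "\<gamma> < c"
    and deriv: "\<And>t. t > 0 \<Longrightarrow> (y has_real_derivative c * tanh t * y t + f t) (at t)"
    and f: "(f \<longlongrightarrow> l) at_top"
    and y: "((\<lambda>t. y t * exp (- \<gamma> * t)) \<longlongrightarrow> 0) at_top"
  shows "(y \<longlongrightarrow> - l / c) at_top"
proof (rule tendstoI)
  fix e :: real assume "e > 0"
  define e1 where "e1 = e / 2"
  have e1: "e1 > 0" using \<open>e > 0\<close> by (simp add: e1_def)
  have rhs: "((\<lambda>t. c * tanh t * (- l / c + \<sigma> * e1) + f t) \<longlongrightarrow> c * 1 * (- l / c + \<sigma> * e1) + l) at_top" for \<sigma>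
    by (intro tendsto_intros tanh_real_at_top f)
  have up: "\<forall>\<^sub>F t in at_top. c * tanh t * (- l / c + 1 * e1) + f t > 0"
    using rhs[of 1] c e1 by (intro order_tendstoD(1)[OF rhs]) (auto simp: algebra_simps)
  have down: "\<forall>\<^sub>F t in at_top. c * tanh t * (- l / c + (-1) * e1) + f t < 0"
    using rhs[of "-1"] c e1 by (intro order_tendstoD(2)[OF rhs]) (auto simp: algebra_simps)
  have "((\<lambda>t. c * tanh t) \<longlongrightarrow> c * 1) at_top"
    by (intro tendsto_intros tanh_real_at_top)
  then have "\<forall>\<^sub>F t in at_top. c * tanh t > \<gamma>"
    using c by (intro order_tendstoD(1)) auto
  from eventually_conj[OF this eventually_conj[OF up down]]
  obtain S where S: "\<And>t. t \<ge> S \<Longrightarrow> c * tanh t > \<gamma>"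
      "\<And>t. t \<ge> S \<Longrightarrow> c * tanh t * (- l / c + 1 * e1) + f t > 0"
      "\<And>t. t \<ge> S \<Longrightarrow> c * tanh t * (- l / c + (-1) * e1) + f t < 0"
    unfolding eventually_at_top_linorder by blast
  have expo: "((\<lambda>t. exp (- \<gamma> * t)) \<longlongrightarrow> 0) at_top"
    using c by real_asymp
  have "y t - (- l / c + e1) \<le> 0" if "t > max S 0" for t
  proof (rule unstable_bound[OF c(1) _ _ _ that])
    fix t assume t: "t > max S 0"
    show "((\<lambda>t. y t - (- l / c + e1)) has_real_derivative c * tanh t * y t + f t) (at t)"
      using t by (auto intro!: derivative_eq_intros deriv)
    assume "y t - (- l / c + e1) > 0"
    then have "\<gamma> * (y t - (- l / c + e1)) \<le> (c * tanh t) * (y t - (- l / c + e1))"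
      using S(1)[of t] t by (intro mult_right_mono) auto
    then show "\<gamma> * (y t - (- l / c + e1)) \<le> c * tanh t * y t + f t"
      using S(2)[of t] t by (simp add: algebra_simps)
  next
    have "((\<lambda>t. y t * exp (- \<gamma> * t) - (- l / c + e1) * exp (- \<gamma> * t)) \<longlongrightarrow> 0 - (- l / c + e1) * 0) at_top"
      by (intro tendsto_intros y expo)
    then show "((\<lambda>t. (y t - (- l / c + e1)) * exp (- \<gamma> * t)) \<longlongrightarrow> 0) at_top"
      by (simp add: algebra_simps)
  qed
  moreover have "(- l / c - e1) - y t \<le> 0" if "t > max S 0" for t
  proof (rule unstable_bound[OF c(1) _ _ _ that])
    fix t assume t: "t > max S 0"
    show "((\<lambda>t. (- l / c - e1) - y t) has_real_derivative - (c * tanh t * y t + f t)) (at t)"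
      using t by (auto intro!: derivative_eq_intros deriv)
    assume "(- l / c - e1) - y t > 0"
    then have "\<gamma> * ((- l / c - e1) - y t) \<le> (c * tanh t) * ((- l / c - e1) - y t)"
      using S(1)[of t] t by (intro mult_right_mono) auto
    then show "\<gamma> * ((- l / c - e1) - y t) \<le> - (c * tanh t * y t + f t)"
      using S(3)[of t] t by (simp add: algebra_simps)
  next
    have "((\<lambda>t. (- l / c - e1) * exp (- \<gamma> * t) - y t * exp (- \<gamma> * t)) \<longlongrightarrow> (- l / c - e1) * 0 - 0) at_top"
      by (intro tendsto_intros y expo)
    then show "((\<lambda>t. ((- l / c - e1) - y t) * exp (- \<gamma> * t)) \<longlongrightarrow> 0) at_top"
      by (simp add: algebra_simps)
  qed
  ultimately have "\<bar>y t - - l / c\<bar> < e" if "t > max S 0" for t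
    using that \<open>e > 0\<close> by (smt (verit, best) e1_def field_sum_of_halves)
  then show "\<forall>\<^sub>F t in at_top. dist (y t) (- l / c) < e"
    unfolding dist_real_def eventually_at_top_dense by blast
qed

text \<open>By Cauchy-Schwarz the squared norm, multiplied by \<open>exp (- 2 * L * t)\<close> or
  \<open>exp (2 * L * t)\<close>, is monotone. The lower bound is what keeps orbits off the
  origin.\<close>

lemma lipschitz_growth_bounds:
  fixes d :: "real \<Rightarrow> 'a::real_inner"
  assumes cont: "continuous_on {0..} d"
    and deriv: "\<And>t. t > 0 \<Longrightarrow> (d has_vector_derivative v t) (at t)"
    and bound: "\<And>t. t > 0 \<Longrightarrow> norm (v t) \<le> L * norm (d t)"
    and t: "t \<ge> 0"
  shows "norm (d t) \<le> exp (L * t) * norm (d 0)" "exp (- L * t) * norm (d 0) \<le> norm (d t)"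
proof -
  have cont': "continuous_on {0..t} d" using cont by (rule continuous_on_subset) auto
  have deriv': "((\<lambda>s. exp (c * s) * (d s \<bullet> d s)) has_real_derivative
      exp (c * s) * (c * (d s \<bullet> d s) + 2 * (d s \<bullet> v s))) (at s)" if "s > 0" for s c
  proof -
    have "((\<lambda>s. d s \<bullet> d s) has_real_derivative 2 * (d s \<bullet> v s)) (at s)"
      using deriv[OF that] unfolding has_field_derivative_def has_vector_derivative_def
      by (auto intro!: derivative_eq_intros simp: inner_commute algebra_simps)
    then show ?thesis by (auto intro!: derivative_eq_intros simp: algebra_simps)
  qed
  have dv: "\<bar>d s \<bullet> v s\<bar> \<le> L * (d s \<bullet> d s)" if "s > 0" for s
  proof -
    have "\<bar>d s \<bullet> v s\<bar> \<le> norm (d s) * norm (v s)" by (rule Cauchy_Schwarz_ineq2)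
    also have "\<dots> \<le> norm (d s) * (L * norm (d s))"
      using bound[OF that] by (rule mult_left_mono) auto
    finally show ?thesis by (simp add: dot_square_norm power2_eq_square mult_ac)
  qed
  have "- (exp (- 2 * L * 0) * (d 0 \<bullet> d 0)) \<le> - (exp (- 2 * L * t) * (d t \<bullet> d t))"
  proof (rule DERIV_nonneg_imp_increasing_open[OF t])
    fix s :: real assume s: "0 < s" "s < t"
    have "((\<lambda>s. - (exp (- 2 * L * s) * (d s \<bullet> d s))) has_real_derivative
      - (exp (- 2 * L * s) * (- 2 * L * (d s \<bullet> d s) + 2 * (d s \<bullet> v s)))) (at s)"
      by (rule DERIV_minus[OF deriv'[OF s(1), of "- 2 * L"]])
    moreover have "- (exp (- 2 * L * s) * (- 2 * L * (d s \<bullet> d s) + 2 * (d s \<bullet> v s))) \<ge> 0"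
      using dv[OF s(1)] by (auto simp: mult_le_0_iff)
    ultimately show "\<exists>y. ((\<lambda>s. - (exp (- 2 * L * s) * (d s \<bullet> d s))) has_real_derivative y) (at s) \<and> 0 \<le> y"
      by blast
  qed (intro continuous_intros cont')
  then have "d t \<bullet> d t \<le> exp (2 * L * t) * (d 0 \<bullet> d 0)"
    by (simp add: exp_minus field_simps)
  also have "\<dots> = (exp (L * t) * norm (d 0))\<^sup>2"
    by (simp add: power_mult_distrib dot_square_norm exp_double[symmetric] mult_ac)
  finally show "norm (d t) \<le> exp (L * t) * norm (d 0)"
    by (simp add: dot_square_norm power2_le_iff_abs_le)
  have "exp (2 * L * 0) * (d 0 \<bullet> d 0) \<le> exp (2 * L * t) * (d t \<bullet> d t)"
  proof (rule DERIV_nonneg_imp_increasing_open[OF t])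
    fix s :: real assume s: "0 < s" "s < t"
    have "exp (2 * L * s) * (2 * L * (d s \<bullet> d s) + 2 * (d s \<bullet> v s)) \<ge> 0"
      using dv[OF s(1)] by auto
    with deriv'[OF s(1), of "2 * L"]
    show "\<exists>y. ((\<lambda>s. exp (2 * L * s) * (d s \<bullet> d s)) has_real_derivative y) (at s) \<and> 0 \<le> y"
      by blast
  qed (intro continuous_intros cont')
  then have "exp (- (2 * L * t)) * (d 0 \<bullet> d 0) \<le> d t \<bullet> d t"
    by (simp add: exp_minus field_simps)
  moreover have "exp (- (2 * L * t)) * (d 0 \<bullet> d 0) = (exp (- L * t) * norm (d 0))\<^sup>2"
    by (simp add: power_mult_distrib dot_square_norm exp_double[symmetric] mult_ac)
  ultimately show "exp (- L * t) * norm (d 0) \<le> norm (d t)"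
    by (simp add: dot_square_norm power2_le_iff_abs_le)
qed

text \<open>The angle is defined as the integral of the angular velocity \<open>F\<close>, which
  makes it a continuous lift by construction. That it is an angle of the curve is checked in the
  co-rotating normalized frame.\<close>

lemma polar_angle_exists:
  fixes x y x' y' :: "real \<Rightarrow> real"
  assumes cont: "continuous_on {0..} x" "continuous_on {0..} y"
      "continuous_on {0..} x'" "continuous_on {0..} y'"
    and x': "\<And>t. t > 0 \<Longrightarrow> (x has_real_derivative x' t) (at t)"
    and y': "\<And>t. t > 0 \<Longrightarrow> (y has_real_derivative y' t) (at t)"
    and pos: "\<And>t. t \<ge> 0 \<Longrightarrow> (x t)\<^sup>2 + (y t)\<^sup>2 > 0"
    and start: "x 0 > 0" "y 0 = 0"
  shows "\<exists>\<phi>. continuous_on {0..} \<phi> \<and> \<phi> 0 = 0 \<and>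
    (\<forall>t\<ge>0. x t = sqrt ((x t)\<^sup>2 + (y t)\<^sup>2) * cos (\<phi> t) \<and> y t = sqrt ((x t)\<^sup>2 + (y t)\<^sup>2) * sin (\<phi> t)) \<and>
    (\<forall>t>0. (\<phi> has_real_derivative (x t * y' t - y t * x' t) / ((x t)\<^sup>2 + (y t)\<^sup>2)) (at t))"
proof -
  define R where "R t = (x t)\<^sup>2 + (y t)\<^sup>2" for t
  define F where "F t = (x t * y' t - y t * x' t) / R t" for t
  define \<alpha> where "\<alpha> t = (x t * x' t + y t * y' t) / R t" for t
  have R: "R t > 0" if "t \<ge> 0" for t using pos[OF that] by (simp add: R_def)
  have F_cont: "continuous_on {0..} F"
    unfolding F_def R_def using pos by (intro continuous_intros cont) force
  define \<phi> where "\<phi> t = integral {0..t} F" for t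
  have within: "(\<phi> has_real_derivative F t) (at t within {0..t+1})" if "t \<ge> 0" for t
    unfolding \<phi>_def
    by (rule integral_has_real_derivative) (use that in \<open>auto intro: continuous_on_subset[OF F_cont]\<close>)
  have \<phi>_cont: "continuous_on {0..} \<phi>"
    unfolding continuous_on_eq_continuous_within
  proof
    fix r :: real assume "r \<in> {0..}"
    then have "continuous (at r within {0..r+1}) \<phi>"
      using within[of r] DERIV_continuous by auto
    moreover have "at r within {0..r+1} = at r within {0..}"
      by (rule at_within_nhd[of _ "{..<r+1}"]) auto
    ultimately show "continuous (at r within {0..}) \<phi>" by simp
  qed
  have \<phi>': "(\<phi> has_real_derivative F t) (at t)" if "t > 0" for t
    using within[of t] that by (simp add: at_within_Icc_at)
  have x'_eq: "x' t = \<alpha> t * x t - F t * y t" and y'_eq: "y' t = \<alpha> t * y t + F t * x t"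
    if "t \<ge> 0" for t
  proof -
    have "R t * x' t = (x t * x' t + y t * y' t) * x t - (x t * y' t - y t * x' t) * y t"
      by (simp add: R_def power2_eq_square algebra_simps)
    then show "x' t = \<alpha> t * x t - F t * y t" using R[OF that] by (simp add: \<alpha>_def F_def field_simps)
    have "R t * y' t = (x t * x' t + y t * y' t) * y t + (x t * y' t - y t * x' t) * x t"
      by (simp add: R_def power2_eq_square algebra_simps)
    then show "y' t = \<alpha> t * y t + F t * x t" using R[OF that] by (simp add: \<alpha>_def F_def field_simps)
  qed
  \<comment> \<open>\<open>A\<close> and \<open>B\<close> are the coordinates after rotating by
    \<open>- \<phi>\<close> and normalizing. The rotation cancels \<open>F\<close> and the
    normalization cancels the radial rate \<open>\<alpha>\<close>, so they keep their initial values
    1 and 0.\<close>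
  define A where "A t = (x t * cos (\<phi> t) + y t * sin (\<phi> t)) / sqrt (R t)" for t
  define B where "B t = (y t * cos (\<phi> t) - x t * sin (\<phi> t)) / sqrt (R t)" for t
  have R': "(R has_real_derivative 2 * \<alpha> t * R t) (at t)" if "t > 0" for t
    unfolding R_def using that x'[OF that] y'[OF that] x'_eq[of t] y'_eq[of t]
    by (auto intro!: derivative_eq_intros simp: algebra_simps power2_eq_square)
  have sqrtR': "((\<lambda>t. sqrt (R t)) has_real_derivative \<alpha> t * sqrt (R t)) (at t)" if "t > 0" for t
  proof -
    have "((\<lambda>t. sqrt (R t)) has_real_derivative (2 * \<alpha> t * R t) * (inverse (sqrt (R t)) / 2)) (at t)"
      using R'[OF that] R[of t] that by (auto intro!: derivative_eq_intros)
    moreover have "(2 * \<alpha> t * R t) * (inverse (sqrt (R t)) / 2) = \<alpha> t * sqrt (R t)"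
      using R[of t] that by (simp add: field_simps)
    ultimately show ?thesis by (rule DERIV_cong)
  qed
  have "A t = 1 \<and> B t = 0" if t: "t \<ge> 0" for t
  proof -
    have numA: "((\<lambda>t. x t * cos (\<phi> t) + y t * sin (\<phi> t)) has_real_derivative
        \<alpha> s * (x s * cos (\<phi> s) + y s * sin (\<phi> s))) (at s)" if "s > 0" for s
      using that x'[OF that] y'[OF that] \<phi>'[OF that] x'_eq[of s] y'_eq[of s]
      by (auto intro!: derivative_eq_intros simp: algebra_simps)
    have numB: "((\<lambda>t. y t * cos (\<phi> t) - x t * sin (\<phi> t)) has_real_derivative
        \<alpha> s * (y s * cos (\<phi> s) - x s * sin (\<phi> s))) (at s)" if "s > 0" for s
      using that x'[OF that] y'[OF that] \<phi>'[OF that] x'_eq[of s] y'_eq[of s]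
      by (auto intro!: derivative_eq_intros simp: algebra_simps)
    have quot: "((\<lambda>t. N t / sqrt (R t)) has_real_derivative 0) (at s)"
      if "s > 0" "(N has_real_derivative \<alpha> s * N s) (at s)" for s N
      using DERIV_divide[OF that(2) sqrtR'[OF that(1)]] R[of s] that(1) by (simp add: mult_ac)
    have const: "(\<lambda>t. N t / sqrt (R t)) t = (\<lambda>t. N t / sqrt (R t)) 0"
      if N': "\<And>s. s > 0 \<Longrightarrow> (N has_real_derivative \<alpha> s * N s) (at s)" and "continuous_on {0..} N" for N
    proof (cases "t = 0")
      case False
      have contR: "continuous_on {0..t} (\<lambda>t. N t / sqrt (R t))"
        unfolding R_def using pos that(2)
        by (intro continuous_intros continuous_on_subset[OF cont(1)] continuous_on_subset[OF cont(2)]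
            continuous_on_subset[OF that(2)]) (force simp: real_sqrt_eq_0_iff)+
      show ?thesis
        by (rule DERIV_isconst2[OF _ contR]) (use t False quot N' in auto)
    qed simp
    have "A t = A 0" "B t = B 0"
      unfolding A_def B_def
      by (rule const; intro numA numB continuous_intros cont \<phi>_cont; assumption)+
    moreover have "A 0 = 1" "B 0 = 0" using start by (simp_all add: A_def B_def R_def \<phi>_def)
    ultimately show ?thesis by simp
  qed
  moreover have "x t = sqrt (R t) * (A t * cos (\<phi> t) - B t * sin (\<phi> t)) \<and>
      y t = sqrt (R t) * (A t * sin (\<phi> t) + B t * cos (\<phi> t))" if "t \<ge> 0" for t
  proof -
    have s: "sqrt (R t) * A t = x t * cos (\<phi> t) + y t * sin (\<phi> t)"
      "sqrt (R t) * B t = y t * cos (\<phi> t) - x t * sin (\<phi> t)"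
      using R[OF that] by (simp_all add: A_def B_def)
    have "sqrt (R t) * (A t * cos (\<phi> t) - B t * sin (\<phi> t)) =
        (sqrt (R t) * A t) * cos (\<phi> t) - (sqrt (R t) * B t) * sin (\<phi> t)"
      by (simp add: algebra_simps)
    also have "\<dots> = x t * ((sin (\<phi> t))\<^sup>2 + (cos (\<phi> t))\<^sup>2)"
      unfolding s power2_eq_square by (simp only: algebra_simps)
    finally have x_eq: "sqrt (R t) * (A t * cos (\<phi> t) - B t * sin (\<phi> t)) = x t" by simp
    have "sqrt (R t) * (A t * sin (\<phi> t) + B t * cos (\<phi> t)) =
        (sqrt (R t) * A t) * sin (\<phi> t) + (sqrt (R t) * B t) * cos (\<phi> t)"
      by (simp add: algebra_simps)
    also have "\<dots> = y t * ((sin (\<phi> t))\<^sup>2 + (cos (\<phi> t))\<^sup>2)"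
      unfolding s power2_eq_square by (simp only: algebra_simps)
    finally have "sqrt (R t) * (A t * sin (\<phi> t) + B t * cos (\<phi> t)) = y t" by simp
    with x_eq show ?thesis by simp
  qed
  ultimately show ?thesis
    using \<phi>_cont \<phi>' unfolding R_def F_def by (intro exI[of _ \<phi>]) (auto simp: \<phi>_def)
qed

section \<open>The shooting problem\<close>

text \<open>Beyond 30 the exponential is replaced by slope 1, which is globally Lipschitz and still
  dominates \<open>1 + w\<close> for \<open>w \<ge> 0\<close>. The height is
  \<open>2 + 4 * m\<close> at \<open>m = 7\<close>, the bound that the barrier and the energy give
  in \<open>w_le_30\<close>.\<close>

definition trunc_exp :: "real \<Rightarrow> real" where
  "trunc_exp w = exp (min w 30) + max 0 (w - 30)"

lemma trunc_exp_eq: "w \<le> 30 \<Longrightarrow> trunc_exp w = exp w"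
  by (simp add: trunc_exp_def)

lemma trunc_exp_pos: "trunc_exp w > 0"
  by (simp add: trunc_exp_def add_pos_nonneg)

lemma trunc_exp_ge: "w \<ge> 0 \<Longrightarrow> 1 + w \<le> trunc_exp w"
  using exp_ge_add_one_self[of w] exp_ge_add_one_self[of "30::real"]
  by (auto simp: trunc_exp_def min_def max_def)

lemma trunc_exp_continuous [continuous_intros]:
  "continuous_on A f \<Longrightarrow> continuous_on A (\<lambda>x. trunc_exp (f x))"
  unfolding trunc_exp_def by (intro continuous_intros)

lemma trunc_exp_lipschitz: "\<bar>trunc_exp x - trunc_exp y\<bar> \<le> (exp 30 + 1) * \<bar>x - y\<bar>"
proof -
  have exp_lip: "exp v - exp u \<le> exp 30 * (v - u)" if "u \<le> v" "v \<le> 30" for u v :: real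
  proof -
    have "exp v * (1 - (v - u)) \<le> exp v * exp (u - v)"
      using exp_ge_add_one_self[of "u - v"] by (intro mult_left_mono) (linarith, simp)
    also have "\<dots> = exp u" by (simp add: exp_add[symmetric])
    finally have "exp v - exp u \<le> exp v * (v - u)" by (simp add: algebra_simps)
    also have "\<dots> \<le> exp 30 * (v - u)" using that by (intro mult_right_mono) auto
    finally show ?thesis .
  qed
  have le: "trunc_exp v - trunc_exp u \<le> (exp 30 + 1) * (v - u) \<and> trunc_exp u \<le> trunc_exp v"
    if "u \<le> v" for u v
  proof -
    have "exp (min v 30) - exp (min u 30) \<le> exp 30 * (min v 30 - min u 30)"
      using that by (intro exp_lip) auto
    also have "\<dots> \<le> exp 30 * (v - u)" using that by (intro mult_left_mono) auto
    finally have "exp (min v 30) - exp (min u 30) \<le> exp 30 * (v - u)" .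
    moreover have "max 0 (v - 30) - max 0 (u - 30) \<le> v - u" using that by auto
    moreover have "exp (min u 30) \<le> exp (min v 30)" using that by auto
    moreover have "max 0 (u - 30) \<le> max 0 (v - 30)" using that by auto
    ultimately show ?thesis
      unfolding trunc_exp_def distrib_right mult_1 by (intro conjI) linarith+
  qed
  show ?thesis using le[of x y] le[of y x] by (cases "x \<le> y") auto
qed

text \<open>For negative \<open>w\<close>, \<open>exp w \<le> 1 / (1 - w)\<close> gives
  \<open>1 - exp w \<ge> - w / (1 - w)\<close>, and \<open>1 - w \<le> 16/15\<close> on the given
  range. The loss of 1/16 is small enough for the spiral to survive at \<open>m = 7\<close>.\<close>

lemma trunc_exp_times_ge:
  assumes "w \<ge> - 1/15"
  shows "(trunc_exp w - 1) * w \<ge> 15/16 * w\<^sup>2"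
proof (cases "w \<ge> 0")
  case True
  have "w * w \<le> (trunc_exp w - 1) * w"
    using trunc_exp_ge[OF True] True by (intro mult_right_mono) auto
  moreover have "15/16 * w\<^sup>2 \<le> w * w" by (simp add: power2_eq_square)
  ultimately show ?thesis by linarith
next
  case False
  have "exp w \<le> 1 / (1 - w)"
    using exp_ge_add_one_self[of "- w"] False by (simp add: exp_minus field_simps)
  then have "(1 - exp w) * (1 - w) \<ge> - w"
    using False by (simp add: field_simps)
  moreover have "(1 - exp w) * (1 - w) \<le> (1 - exp w) * (16/15)"
    using assms False by (intro mult_left_mono) auto
  ultimately have "- w \<le> (1 - exp w) * (16/15)" by (rule order_trans)
  then have "(15/16) * (- w) \<le> 1 - exp w" by (simp add: field_simps)
  then have "(15/16) * (- w) * (- w) \<le> (1 - exp w) * (- w)"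
    using False by (intro mult_right_mono) auto
  then show ?thesis using False by (simp add: trunc_exp_eq power2_eq_square algebra_simps)
qed

text \<open>The antiderivative of \<open>trunc_exp w - 1\<close> vanishing at 0, which is the
  potential of the restoring force up to the factor \<open>2 * m\<close>.\<close>

definition trunc_pot :: "real \<Rightarrow> real" where
  "trunc_pot w = (if w \<le> 30 then exp w - 1 - w
     else exp 30 * (1 + (w - 30)) + (w - 30)\<^sup>2 / 2 - 1 - w)"

lemma trunc_pot_deriv: "(trunc_pot has_real_derivative trunc_exp w - 1) (at w)"
proof -
  have "((\<lambda>w. if w \<in> {..30} then exp w - 1 - w
      else exp 30 * (1 + (w - 30)) + (w - 30)\<^sup>2 / 2 - 1 - w) has_vector_derivative
      (if w \<in> {..30} then exp w - 1 else exp 30 + (w - 30) - 1)) (at w within UNIV)"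
    by (rule has_vector_derivative_If_within_closures[where T = "{30..}"])
      (auto intro!: derivative_eq_intros
        simp: has_real_derivative_iff_has_vector_derivative[symmetric] field_simps)
  then show ?thesis
    by (auto simp: trunc_pot_def[abs_def] trunc_exp_def has_real_derivative_iff_has_vector_derivative
        max_def min_def)
qed

lemma trunc_pot_0 [simp]: "trunc_pot 0 = 0"
  by (simp add: trunc_pot_def)

lemma trunc_pot_ge:
  assumes "w \<ge> 0"
  shows "trunc_pot w \<ge> w\<^sup>2 / 2"
proof (cases "w \<le> 30")
  case True
  then show ?thesis using exp_lower_Taylor_quadratic[OF assms] by (simp add: trunc_pot_def)
next
  case False
  have "exp 30 \<ge> (1 + 30 + 30\<^sup>2 / 2 :: real)" by (rule exp_lower_Taylor_quadratic) simp
  then have "481 * (1 + (w - 30)) \<le> exp 30 * (1 + (w - 30))"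
    using False by (intro mult_right_mono) auto
  moreover have "(w - 30)\<^sup>2 / 2 = w\<^sup>2 / 2 - 30 * w + 450"
    by (simp add: power2_diff field_simps)
  ultimately have "w\<^sup>2 / 2 \<le> exp 30 * (1 + (w - 30)) + (w - 30)\<^sup>2 / 2 - 1 - w"
    using False by argo
  then show ?thesis using False by (simp add: trunc_pot_def)
qed

definition shooting_field :: "real \<Rightarrow> real \<Rightarrow> real \<times> real \<Rightarrow> real \<times> real" where
  "shooting_field m t x = (snd x, m * tanh t * snd x - 2 * m * (trunc_exp (fst x) - 1))"

text \<open>Uniform in \<open>m \<le> 7\<close>: the velocity contributes \<open>1 + 7\<close>, and
  the restoring force 14 times the Lipschitz constant of \<open>trunc_exp\<close>.\<close>

definition shooting_lip :: real where
  "shooting_lip = 8 + 14 * (exp 30 + 1)"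

lemma shooting_field_lipschitz:
  assumes "1 \<le> m" "m \<le> 7"
  shows "norm (shooting_field m t x - shooting_field m t y) \<le> shooting_lip * norm (x - y)"
proof -
  have n: "\<bar>fst x - fst y\<bar> \<le> norm (x - y)" "\<bar>snd x - snd y\<bar> \<le> norm (x - y)"
    using norm_fst_le[of "fst (x - y)" "snd (x - y)"] norm_snd_le[of "snd (x - y)" "fst (x - y)"]
    by (auto simp: minus_prod_def)
  have "m * \<bar>tanh t\<bar> \<le> 7 * 1"
    using assms tanh_real_bounds[of t] by (intro mult_mono) auto
  then have "(m * \<bar>tanh t\<bar>) * \<bar>snd x - snd y\<bar> \<le> 7 * norm (x - y)"
    using n assms by (intro mult_mono) auto
  moreover have "(2 * m) * \<bar>trunc_exp (fst x) - trunc_exp (fst y)\<bar> \<le> 14 * ((exp 30 + 1) * norm (x - y))"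
  proof (rule mult_mono)
    show "\<bar>trunc_exp (fst x) - trunc_exp (fst y)\<bar> \<le> (exp 30 + 1) * norm (x - y)"
      by (rule order_trans[OF trunc_exp_lipschitz]) (use n in \<open>auto intro!: mult_left_mono\<close>)
  qed (use assms in auto)
  moreover have "\<bar>m * tanh t * (snd x - snd y) - 2 * m * (trunc_exp (fst x) - trunc_exp (fst y))\<bar>
      \<le> (m * \<bar>tanh t\<bar>) * \<bar>snd x - snd y\<bar> + (2 * m) * \<bar>trunc_exp (fst x) - trunc_exp (fst y)\<bar>"
    using assms by (intro order_trans[OF abs_triangle_ineq4]) (simp add: abs_mult)
  moreover have "norm (shooting_field m t x - shooting_field m t y) \<le> \<bar>snd x - snd y\<bar> +
      \<bar>m * tanh t * (snd x - snd y) - 2 * m * (trunc_exp (fst x) - trunc_exp (fst y))\<bar>"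
    using norm_Pair_le[of "snd x - snd y"
        "m * tanh t * (snd x - snd y) - 2 * m * (trunc_exp (fst x) - trunc_exp (fst y))"]
    by (simp add: shooting_field_def algebra_simps)
  ultimately show ?thesis using n(2) unfolding shooting_lip_def by (simp add: algebra_simps)
qed

text \<open>
  Here \<open>t\<close> is the Mercator coordinate, \<open>tanh t = cos \<theta>\<close>, with the equator at \<open>t = 0\<close> and the north
  pole at \<open>t = \<infinity>\<close>; \<open>w\<close> is the difference of the sought solution and the explicit singular solution
  \<open>ln (m / (m + 1)) - 2 * ln (sin \<theta>)\<close>, where \<open>m = N - 3\<close>; and \<open>\<phi>\<close> is the polar angle of \<open>(w, p)\<close>.
  The exponential is truncated at a height that the orbits of interest never reach.
\<close>

locale shooting_orbit =
  fixes m a :: real and w p \<phi> :: "real \<Rightarrow> real"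
  assumes m: "1 \<le> m" "m \<le> 7" and a: "a > 0"
    and w0: "w 0 = a" and p0: "p 0 = 0" and \<phi>0: "\<phi> 0 = 0"
    and w_cont: "continuous_on {0..} w" and p_cont: "continuous_on {0..} p"
    and \<phi>_cont: "continuous_on {0..} \<phi>"
    and w': "t > 0 \<Longrightarrow> (w has_real_derivative p t) (at t)"
    and p': "t > 0 \<Longrightarrow>
      (p has_real_derivative m * tanh t * p t - 2 * m * (trunc_exp (w t) - 1)) (at t)"
    and \<phi>': "t > 0 \<Longrightarrow> (\<phi> has_real_derivative
      (w t * (m * tanh t * p t - 2 * m * (trunc_exp (w t) - 1)) - p t * p t) /
        ((w t)\<^sup>2 + (p t)\<^sup>2)) (at t)"
    and w_polar: "t \<ge> 0 \<Longrightarrow> w t = sqrt ((w t)\<^sup>2 + (p t)\<^sup>2) * cos (\<phi> t)"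
    and p_polar: "t \<ge> 0 \<Longrightarrow> p t = sqrt ((w t)\<^sup>2 + (p t)\<^sup>2) * sin (\<phi> t)"
    and R_pos: "t \<ge> 0 \<Longrightarrow> (w t)\<^sup>2 + (p t)\<^sup>2 > 0"
begin

lemma field_derivative:
  assumes "t > 0"
  shows "((\<lambda>t. (w t, p t)) has_vector_derivative shooting_field m t (w t, p t)) (at t)"
  using has_vector_derivative_Pair[OF w'[OF assms, unfolded has_real_derivative_iff_has_vector_derivative]
      p'[OF assms, unfolded has_real_derivative_iff_has_vector_derivative]]
  by (simp add: shooting_field_def)

end

lemma shooting_orbit_exists:
  assumes m: "1 \<le> m" "m \<le> 7" and a: "a > 0"
  shows "\<exists>w p \<phi>. shooting_orbit m a w p \<phi>"
proof -
  have L: "shooting_lip > 0" by (simp add: shooting_lip_def add_pos_pos)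
  have zero: "shooting_field m t 0 = 0" for t
    by (simp add: shooting_field_def trunc_exp_eq zero_prod_def)
  have "continuous_on UNIV (\<lambda>(t, x). shooting_field m t x)"
    unfolding shooting_field_def case_prod_beta by (intro continuous_intros) auto
  from global_lipschitz_ivp_exists[OF this L shooting_field_lipschitz[OF m] zero]
  obtain x where x: "x 0 = (a, 0)" "continuous_on {0..} x"
    "\<And>t. t > 0 \<Longrightarrow> (x has_vector_derivative shooting_field m t (x t)) (at t)"
    by blast
  define w where "w t = fst (x t)" for t
  define p where "p t = snd (x t)" for t
  define q where "q t = m * tanh t * p t - 2 * m * (trunc_exp (w t) - 1)" for t
  have w_cont: "continuous_on {0..} w" and p_cont: "continuous_on {0..} p"
    unfolding w_def p_def by (intro continuous_intros x)+
  have q_cont: "continuous_on {0..} q"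
    unfolding q_def by (intro continuous_intros w_cont p_cont) auto
  have w': "(w has_real_derivative p t) (at t)" and p': "(p has_real_derivative q t) (at t)"
    if "t > 0" for t
  proof -
    have "(x has_derivative (\<lambda>h. h *\<^sub>R shooting_field m t (x t))) (at t)"
      using x(3)[OF that] by (simp add: has_vector_derivative_def)
    from has_derivative_fst[OF this] has_derivative_snd[OF this]
    show "(w has_real_derivative p t) (at t)" "(p has_real_derivative q t) (at t)"
      unfolding has_field_derivative_def
      by (auto simp: w_def[abs_def] p_def[abs_def] q_def shooting_field_def
          elim!: has_derivative_eq_rhs)
  qed
  have R: "(w t)\<^sup>2 + (p t)\<^sup>2 > 0" if "t \<ge> 0" for t
  proof -
    \<comment> \<open>The origin is an equilibrium, so the lower growth bound applies to the orbit
      itself and makes its polar angle well defined.\<close>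
    have "exp (- shooting_lip * t) * norm (x 0) \<le> norm (x t)"
    proof (rule lipschitz_growth_bounds(2)[OF x(2) x(3) _ that])
      show "norm (shooting_field m t (x t)) \<le> shooting_lip * norm (x t)" for t
        using shooting_field_lipschitz[OF m, of t "x t" 0] by (simp add: zero)
    qed
    moreover have "exp (- shooting_lip * t) * norm (x 0) > 0"
      using a by (simp add: x(1))
    ultimately have "norm (x t) > 0" by linarith
    then show ?thesis by (auto simp: w_def p_def sum_power2_gt_zero_iff prod_eq_iff)
  qed
  have "w 0 = a" "p 0 = 0" by (simp_all add: w_def p_def x)
  obtain \<phi> where \<phi>: "continuous_on {0..} \<phi>" "\<phi> 0 = 0"
    "\<And>t. t \<ge> 0 \<Longrightarrow> w t = sqrt ((w t)\<^sup>2 + (p t)\<^sup>2) * cos (\<phi> t)"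
    "\<And>t. t \<ge> 0 \<Longrightarrow> p t = sqrt ((w t)\<^sup>2 + (p t)\<^sup>2) * sin (\<phi> t)"
    "\<And>t. t > 0 \<Longrightarrow> (\<phi> has_real_derivative (w t * q t - p t * p t) / ((w t)\<^sup>2 + (p t)\<^sup>2)) (at t)"
    using polar_angle_exists[OF w_cont p_cont p_cont q_cont w' p' R _ \<open>p 0 = 0\<close>]
    unfolding \<open>w 0 = a\<close> using a by blast
  have "shooting_orbit m a w p \<phi>"
    by unfold_locales
      (fact m a \<open>w 0 = a\<close> \<open>p 0 = 0\<close> \<phi> w_cont p_cont w' R p'[unfolded q_def] \<phi>(5)[unfolded q_def])+
  then show ?thesis by blast
qed

lemma shooting_orbit_dist:
  assumes x: "shooting_orbit m a w p \<phi>" and y: "shooting_orbit m b v q \<psi>" and t: "t \<ge> 0"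
  shows "norm ((w t, p t) - (v t, q t)) \<le> exp (shooting_lip * t) * \<bar>a - b\<bar>"
proof -
  interpret x: shooting_orbit m a w p \<phi> by fact
  interpret y: shooting_orbit m b v q \<psi> by fact
  have "norm ((w t, p t) - (v t, q t)) \<le> exp (shooting_lip * t) * norm ((w 0, p 0) - (v 0, q 0))"
  proof (rule lipschitz_growth_bounds(1)[OF _ _ _ t])
    show "continuous_on {0..} (\<lambda>t. (w t, p t) - (v t, q t))"
      by (intro continuous_intros x.w_cont x.p_cont y.w_cont y.p_cont)
    show "((\<lambda>t. (w t, p t) - (v t, q t)) has_vector_derivative
      shooting_field m t (w t, p t) - shooting_field m t (v t, q t)) (at t)" if "t > 0" for t
      by (intro has_vector_derivative_diff x.field_derivative y.field_derivative that)
  qed (rule shooting_field_lipschitz[OF x.m])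
  also have "norm ((w 0, p 0) - (v 0, q 0)) = \<bar>a - b\<bar>"
    by (simp add: x.w0 x.p0 y.w0 y.p0)
  finally show ?thesis .
qed

section \<open>Clockwise rotation in the phase plane\<close>

context shooting_orbit
begin

lemma norm_le:
  assumes t: "t \<ge> 0"
  shows "norm (w t, p t) \<le> exp (shooting_lip * t) * a"
proof -
  have "norm (w t, p t) \<le> exp (shooting_lip * t) * norm (w 0, p 0)"
  proof (rule lipschitz_growth_bounds(1)[OF _ field_derivative _ t])
    show "continuous_on {0..} (\<lambda>t. (w t, p t))"
      by (intro continuous_intros w_cont p_cont)
    show "norm (shooting_field m t (w t, p t)) \<le> shooting_lip * norm (w t, p t)" for t
      using shooting_field_lipschitz[OF m, of t "(w t, p t)" 0]
      by (simp add: shooting_field_def trunc_exp_eq)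
  qed
  then show ?thesis using a by (simp add: w0 p0)
qed

text \<open>The spiral, made quantitative: the numerator of the angular velocity is at most a
  quadratic form whose discriminant \<open>m\<^sup>2 - 15/2 * m\<close> is negative for
  \<open>1 \<le> m \<le> 7\<close>. Splitting the mixed term with weight 49/50 on
  \<open>y\<^sup>2\<close> leaves 1/50 of both squares.\<close>

lemma angle_rate:
  assumes t: "t > 0" and w: "w t \<ge> - 1/15"
  shows "\<exists>d \<le> - 1/50. (\<phi> has_real_derivative d) (at t)"
proof -
  define x where "x = w t"
  define y where "y = p t"
  have \<tau>: "0 \<le> tanh t" "tanh t \<le> 1" using t tanh_real_lt_1[of t] by auto
  have "(m * tanh t) * (x * y) \<le> m * (\<bar>x\<bar> * \<bar>y\<bar>)"
  proof -
    have "(m * tanh t) * (x * y) \<le> (m * tanh t) * \<bar>x * y\<bar>"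
      using m \<tau> by (intro mult_left_mono) auto
    also have "\<dots> \<le> (m * 1) * \<bar>x * y\<bar>"
      using m \<tau> by (intro mult_right_mono mult_left_mono) auto
    finally show ?thesis by (simp add: abs_mult)
  qed
  also have "\<dots> \<le> 49/50 * y\<^sup>2 + 50/196 * m\<^sup>2 * x\<^sup>2"
  proof -
    have "0 \<le> 49/50 * (\<bar>y\<bar> - 25/49 * m * \<bar>x\<bar>)\<^sup>2" by simp
    also have "\<dots> = 49/50 * y\<^sup>2 + 50/196 * m\<^sup>2 * x\<^sup>2 - m * (\<bar>x\<bar> * \<bar>y\<bar>)"
      by (simp add: power2_eq_square algebra_simps)
    finally show ?thesis by simp
  qed
  also have "50/196 * m\<^sup>2 * x\<^sup>2 \<le> (15/8 * m - 1/50) * x\<^sup>2"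
  proof (rule mult_right_mono)
    have "m * m \<le> m * 7" using m by (intro mult_left_mono) auto
    then show "50/196 * m\<^sup>2 \<le> 15/8 * m - 1/50"
      using m unfolding power2_eq_square by linarith
  qed simp
  also have "(15/8 * m - 1/50) * x\<^sup>2 \<le> 2 * m * ((trunc_exp x - 1) * x) - 1/50 * x\<^sup>2"
    using mult_left_mono[OF trunc_exp_times_ge[of x], of "2 * m"] m w
    by (simp add: x_def algebra_simps)
  finally have "x * (m * tanh t * y - 2 * m * (trunc_exp x - 1)) - y * y \<le> - 1/50 * (x\<^sup>2 + y\<^sup>2)"
    by (simp add: field_simps power2_eq_square)
  then show ?thesis
    using \<phi>'[OF t] R_pos[of t] t unfolding x_def y_def
    by (intro exI[of _ "(w t * (m * tanh t * p t - 2 * m * (trunc_exp (w t) - 1)) - p t * p t) /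
        ((w t)\<^sup>2 + (p t)\<^sup>2)"]) (simp add: divide_le_eq)
qed

text \<open>Far to the left, where the restoring force is bounded, the angle may increase. On the
  axes it cannot: on \<open>w = 0\<close> the rate is -1, and on \<open>p = 0\<close> the force has
  the sign of \<open>w\<close>. So the multiples of \<open>pi / 2\<close> are one-way gates.\<close>

lemma angle_decreases_on_axes:
  assumes t: "t > 0" and k: "\<phi> t = of_int k * (pi / 2)"
  shows "\<exists>d<0. (\<phi> has_real_derivative d) (at t)"
proof (cases "even k")
  case True
  then obtain j where "k = 2 * j" by blast
  then have "sin (\<phi> t) = 0" using k by (auto simp: sin_zero_iff_int2)
  then have p: "p t = 0" using p_polar[of t] t by simp
  then have "w t \<noteq> 0" using R_pos[of t] t by auto
  moreover have "(trunc_exp (w t) - 1) * w t > 0" if "w t < 0"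
    using that by (simp add: trunc_exp_eq mult_neg_neg)
  moreover have "(trunc_exp (w t) - 1) * w t > 0" if "w t > 0"
    using that trunc_exp_ge[of "w t"] by simp
  ultimately have "(trunc_exp (w t) - 1) * w t > 0" by linarith
  then have "2 * m * ((trunc_exp (w t) - 1) * w t) > 0" using m by simp
  then have "w t * (m * tanh t * p t - 2 * m * (trunc_exp (w t) - 1)) - p t * p t < 0"
    by (simp add: p algebra_simps)
  then have "(w t * (m * tanh t * p t - 2 * m * (trunc_exp (w t) - 1)) - p t * p t) /
      ((w t)\<^sup>2 + (p t)\<^sup>2) < 0"
    using R_pos[of t] t by (intro divide_neg_pos) auto
  then show ?thesis using \<phi>'[OF t] by blast
next
  case False
  then have "cos (\<phi> t) = 0" using k by (auto simp: cos_zero_iff_int)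
  then have w: "w t = 0" using w_polar[of t] t by simp
  then have "p t * p t > 0" using R_pos[of t] t by (simp add: power2_eq_square)
  then have "(\<phi> has_real_derivative - 1) (at t)"
    using \<phi>'[OF t] by (cases "p t = 0") (simp_all add: w power2_eq_square)
  then show ?thesis by (intro exI[of _ "- 1"]) simp
qed

lemma angle_le:
  assumes "s > 0" "\<phi> s \<le> of_int k * (pi / 2)" "t \<ge> s"
  shows "\<phi> t \<le> of_int k * (pi / 2)"
proof (rule downward_barrier[where u = \<phi>, OF _ assms(2) _ assms(3)])
  show "continuous_on {s..t} \<phi>" using assms by (auto intro: continuous_on_subset[OF \<phi>_cont])
qed (use assms angle_decreases_on_axes in auto)

lemma angle_less:
  assumes "s > 0" "\<phi> s \<le> of_int k * (pi / 2)" "t > s"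
  shows "\<phi> t < of_int k * (pi / 2)"
proof (rule ccontr)
  assume "\<not> ?thesis"
  then have eq: "\<phi> t = of_int k * (pi / 2)" using angle_le[OF assms(1,2), of t] assms by auto
  then obtain d where "d < 0" "(\<phi> has_real_derivative d) (at t)"
    using angle_decreases_on_axes[of t k] assms by auto
  then obtain e where "e > 0" and e: "\<And>h. 0 < h \<Longrightarrow> h < e \<Longrightarrow> \<phi> t < \<phi> (t - h)"
    using DERIV_neg_dec_left by blast
  define h where "h = min (e / 2) (t - s)"
  have "0 < h" "h < e" "t - h \<ge> s" using \<open>e > 0\<close> assms by (auto simp: h_def)
  then show False using e[of h] angle_le[OF assms(1,2), of "t - h"] eq by simp
qed

end

section \<open>Winding of orbits\<close>

lemma cos_int_period: "cos (of_int k * (2 * pi)) = 1"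
  and sin_int_period: "sin (of_int k * (2 * pi)) = 0"
  using cos_int_2pin[of k] sin_int_2pin[of k] by (simp_all only: mult.commute)

text \<open>The lifts of the open third quadrant \<open>w < 0\<close>, \<open>p < 0\<close> to the
  angle line; the index \<open>k\<close> plays the role of the winding number.\<close>

definition falling_window :: "int \<Rightarrow> real set" where
  "falling_window k = {of_int (4 * k - 2) * (pi / 2)<..<of_int (4 * k - 1) * (pi / 2)}"

text \<open>The range is one full turn and meets only one lift of the third quadrant. Its slack
  around the window allows angles that are known only approximately.\<close>

lemma falling_windowI:
  assumes neg: "cos x < 0" "sin x < 0"
    and range: "of_int (4 * k - 3) * (pi / 2) \<le> x" "x < of_int (4 * k + 1) * (pi / 2)"
  shows "x \<in> falling_window k"
proof -
  define \<psi> where "\<psi> = x - of_int k * (2 * pi)"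
  have trig: "cos \<psi> < 0" "sin \<psi> < 0"
    using neg unfolding \<psi>_def cos_diff sin_diff cos_int_period sin_int_period
    by simp_all
  have \<psi>: "- (3 * pi / 2) \<le> \<psi>" "\<psi> < pi / 2"
    using range by (simp_all add: \<psi>_def algebra_simps)
  have "\<psi> < - pi / 2" using trig(1) cos_ge_zero[of \<psi>] \<psi> by linarith
  moreover have "- pi < \<psi>"
  proof (rule ccontr)
    assume "\<not> - pi < \<psi>"
    then have "sin (\<psi> + 2 * pi) \<ge> 0" using \<psi> by (intro sin_ge_zero) auto
    then show False using trig by simp
  qed
  ultimately show ?thesis by (simp add: falling_window_def \<psi>_def algebra_simps)
qed

lemma falling_window_signs:
  assumes "x \<in> falling_window k"
  shows "cos x < 0" "sin x < 0"
proof -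
  define \<psi> where "\<psi> = x - of_int k * (2 * pi)"
  have \<psi>: "- pi < \<psi>" "\<psi> < - (pi / 2)"
    using assms by (simp_all add: falling_window_def \<psi>_def algebra_simps)
  have "cos (\<psi> + pi) > 0" "sin (\<psi> + pi) > 0"
    using \<psi> by (intro cos_gt_zero_pi sin_gt_zero; simp)+
  then have "cos \<psi> < 0" "sin \<psi> < 0" by simp_all
  then show "cos x < 0" "sin x < 0"
    unfolding \<psi>_def cos_diff sin_diff cos_int_period sin_int_period by simp_all
qed

lemma falling_window_unique:
  assumes "x \<in> falling_window k" "x \<in> falling_window j"
  shows "k = j"
proof -
  have le: "k' \<le> j'" if "x \<in> falling_window k'" "x \<in> falling_window j'" for k' j'
  proof -
    have "of_int (4 * k' - 2) * (pi / 2) < x" "x < of_int (4 * j' - 1) * (pi / 2)"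
      using that unfolding falling_window_def greaterThanLessThan_iff by blast+
    then have "of_int (4 * k' - 2) * (pi / 2) < of_int (4 * j' - 1) * (pi / 2)"
      by (rule less_trans)
    then have "4 * k' - 2 < 4 * j' - 1"
      by (simp only: mult_less_cancel_right_pos[OF pi_half_gt_zero] of_int_less_iff)
    then show ?thesis by simp
  qed
  show ?thesis using le[of k j] le[of j k] assms by simp
qed

section \<open>Barrier, energy and the fate of an orbit\<close>

context shooting_orbit
begin

lemma angle_signs:
  assumes "t \<ge> 0"
  shows "w t > 0 \<longleftrightarrow> cos (\<phi> t) > 0" "w t < 0 \<longleftrightarrow> cos (\<phi> t) < 0"
    "p t > 0 \<longleftrightarrow> sin (\<phi> t) > 0" "p t < 0 \<longleftrightarrow> sin (\<phi> t) < 0"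
proof -
  define r where "r = sqrt ((w t)\<^sup>2 + (p t)\<^sup>2)"
  have r: "r > 0" using R_pos[OF assms] by (simp add: r_def)
  have "w t = r * cos (\<phi> t)" "p t = r * sin (\<phi> t)"
    using w_polar[OF assms] p_polar[OF assms] by (simp_all add: r_def)
  then show "w t > 0 \<longleftrightarrow> cos (\<phi> t) > 0" "w t < 0 \<longleftrightarrow> cos (\<phi> t) < 0"
    "p t > 0 \<longleftrightarrow> sin (\<phi> t) > 0" "p t < 0 \<longleftrightarrow> sin (\<phi> t) < 0"
    using r by (simp_all add: zero_less_mult_iff mult_less_0_iff)
qed

text \<open>The constant 2 is the asymptotic falling speed of a regular orbit. The second term pays
  for \<open>tanh t < 1\<close>: its derivative absorbs
  \<open>2 * m * (1 - tanh t) \<le> 4 * m * exp (- t)\<close>.\<close>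

definition barrier :: "real \<Rightarrow> real" where
  "barrier t = 2 + 4 * m * exp (- t)"

lemma barrier_le: "t \<ge> 0 \<Longrightarrow> barrier t \<le> 2 + 4 * m"
  using m by (simp add: barrier_def)

lemma barrier_ge: "barrier t \<ge> 2"
  using m by (simp add: barrier_def)

text \<open>For \<open>u = p + barrier\<close> the anti-damping contributes
  \<open>m * tanh r * u\<close>, negative once \<open>u < 0\<close>; what remains of the forcing is
  dominated by the decay of the barrier. Hence the gap never shrinks.\<close>

lemma below_barrier:
  assumes s: "s > 0" "p s < - barrier s" and t: "t \<ge> s"
  shows "p t < - barrier t"
proof -
  define u where "u t = p t + barrier t" for t
  have "u t \<le> u s"
  proof (rule downward_barrier[OF _ order_refl _ t])
    show "continuous_on {s..t} u"
      unfolding u_def barrier_def using s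
      by (intro continuous_intros continuous_on_subset[OF p_cont]) auto
    fix r assume r: "s \<le> r" "r < t" "u r = u s"
    have neg: "u r < 0" using r s by (simp add: u_def)
    have r0: "r > 0" using r s by simp
    define d where "d = m * tanh r * p r - 2 * m * (trunc_exp (w r) - 1) - 4 * m * exp (- r)"
    have "(u has_real_derivative d) (at r)"
      unfolding u_def barrier_def d_def using r0
      by (auto intro!: derivative_eq_intros p')
    moreover have "d < 0"
    proof -
      have "1 - tanh r \<le> 2 * exp (- r)"
      proof -
        have "1 - tanh r = 2 * exp (- 2 * r) / (1 + exp (- 2 * r))"
        proof -
          have "1 - (1 - e) / (1 + e) = 2 * e / (1 + e)" if "e > 0" for e :: real
            using that by (simp add: field_simps)
          then show ?thesis by (simp add: tanh_real_altdef)
        qed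
        also have "\<dots> \<le> 2 * exp (- 2 * r)" by (simp add: divide_le_eq add_pos_pos)
        also have "\<dots> \<le> 2 * exp (- r)" using r0 by simp
        finally show ?thesis .
      qed
      then have "2 * m * (1 - tanh r) \<le> 2 * m * (2 * exp (- r))"
        using m by (intro mult_left_mono) auto
      moreover have "m * tanh r * u r \<le> 0"
        using neg m r0 by (intro mult_nonneg_nonpos) auto
      moreover have "m * tanh r * (4 * m * exp (- r)) \<ge> 0"
        using m r0 by (intro mult_nonneg_nonneg) auto
      moreover have "2 * m * trunc_exp (w r) > 0" using m trunc_exp_pos[of "w r"] by simp
      moreover have "d = m * tanh r * u r - m * tanh r * (4 * m * exp (- r)) + 2 * m * (1 - tanh r)
          - 2 * m * trunc_exp (w r) - 4 * m * exp (- r)"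
        by (simp add: d_def u_def barrier_def algebra_simps)
      ultimately show ?thesis by linarith
    qed
    ultimately show "\<exists>d<0. (u has_real_derivative d) (at r)" by blast
  qed
  then show ?thesis using s by (simp add: u_def)
qed

definition energy :: "real \<Rightarrow> real" where
  "energy t = (p t)\<^sup>2 / 2 + 2 * m * trunc_pot (w t)"

lemma energy_deriv:
  assumes "t > 0"
  shows "(energy has_real_derivative m * tanh t * (p t)\<^sup>2) (at t)"
  unfolding energy_def
  by (auto intro!: derivative_eq_intros w'[OF assms] p'[OF assms] DERIV_chain2[OF trunc_pot_deriv]
      simp: power2_eq_square field_simps)

lemma energy_cont: "continuous_on {0..} energy"
proof -
  have "continuous_on UNIV trunc_pot"
    by (rule DERIV_continuous_on) (rule trunc_pot_deriv)
  then have "continuous_on {0..} (\<lambda>t. trunc_pot (w t))"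
    by (rule continuous_on_compose2[OF _ w_cont]) auto
  then show ?thesis
    unfolding energy_def by (intro continuous_intros p_cont) auto
qed

lemma energy_mono:
  assumes "0 \<le> s" "s \<le> t"
  shows "energy s \<le> energy t"
proof (rule DERIV_nonneg_imp_increasing_open[OF assms(2)])
  show "continuous_on {s..t} energy"
    using assms by (auto intro: continuous_on_subset[OF energy_cont])
  fix r assume "s < r"
  then have "r > 0" using assms by simp
  moreover have "m * tanh r * (p r)\<^sup>2 \<ge> 0" using m \<open>r > 0\<close> by simp
  ultimately show "\<exists>y. (energy has_real_derivative y) (at r) \<and> 0 \<le> y"
    using energy_deriv by blast
qed

lemma energy_0: "energy 0 \<ge> m * a\<^sup>2"
  using mult_left_mono[OF trunc_pot_ge[of a], of "2 * m"] a m by (simp add: energy_def w0 p0)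

text \<open>While \<open>p \<le> 0\<close> its derivative is below \<open>3 * m\<close>, so
  \<open>p\<close> stays below \<open>- c / 2\<close> for the time \<open>c / (6 * m)\<close>, and
  meanwhile the anti-damping feeds energy at a fixed minimal rate.\<close>

lemma energy_gain:
  assumes c: "c > 0" and s: "s \<ge> 1" "p s \<le> - c"
  shows "energy (s + c / (6 * m)) \<ge> energy s + m * tanh 1 * (c / 2)\<^sup>2 * (c / (6 * m))"
proof -
  define d where "d = c / (6 * m)"
  have d: "d > 0" using c m by (simp add: d_def)
  have p_le: "p t \<le> - (c / 2)" if t: "s \<le> t" "t \<le> s + d" for t
  proof -
    have slope: "3 * m * (r - s) \<le> c / 2" if "r \<le> t" for r
    proof -
      have "3 * m * (r - s) \<le> 3 * m * d" using that t m by (intro mult_left_mono) auto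
      then show ?thesis using m by (simp add: d_def field_simps)
    qed
    have "p t + c - 3 * m * (t - s) \<le> 0"
    proof (rule downward_barrier[where u = "\<lambda>t. p t + c - 3 * m * (t - s)", OF _ _ _ t(1)])
      show "continuous_on {s..t} (\<lambda>t. p t + c - 3 * m * (t - s))"
        using s by (intro continuous_intros continuous_on_subset[OF p_cont]) auto
      fix r assume r: "s \<le> r" "r < t" "p r + c - 3 * m * (r - s) = 0"
      have "p r \<le> 0" using slope[of r] r c by linarith
      then have "m * tanh r * p r \<le> 0" using m r s by (intro mult_nonneg_nonpos) auto
      moreover have "2 * m * trunc_exp (w r) > 0" using m trunc_exp_pos[of "w r"] by simp
      ultimately have "m * tanh r * p r - 2 * m * (trunc_exp (w r) - 1) - 3 * m < 0"
        using m by (simp add: algebra_simps)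
      moreover have "((\<lambda>t. p t + c - 3 * m * (t - s)) has_real_derivative
          m * tanh r * p r - 2 * m * (trunc_exp (w r) - 1) - 3 * m) (at r)"
        using r s by (auto intro!: derivative_eq_intros p')
      ultimately show "\<exists>d<0. ((\<lambda>t. p t + c - 3 * m * (t - s)) has_real_derivative d) (at r)"
        by blast
    qed (use s in simp)
    then show ?thesis using slope[of t] by linarith
  qed
  define \<gamma> where "\<gamma> = m * tanh 1 * (c / 2)\<^sup>2"
  have "energy s - \<gamma> * s \<le> energy (s + d) - \<gamma> * (s + d)"
  proof (rule DERIV_nonneg_imp_nondecreasing[where f = "\<lambda>t. energy t - \<gamma> * t"])
    fix r assume r: "s \<le> r" "r \<le> s + d"
    have "((\<lambda>t. energy t - \<gamma> * t) has_real_derivative m * tanh r * (p r)\<^sup>2 - \<gamma>) (at r)"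
      using r s by (auto intro!: derivative_eq_intros energy_deriv)
    moreover have "(c / 2)\<^sup>2 \<le> (p r)\<^sup>2"
      using p_le[OF r] c power_mono[of "c / 2" "- p r" 2] by simp
    then have "\<gamma> \<le> m * tanh r * (p r)\<^sup>2"
      unfolding \<gamma>_def using m r s by (intro mult_mono) auto
    ultimately show "\<exists>y. ((\<lambda>t. energy t - \<gamma> * t) has_real_derivative y) (at r) \<and> 0 \<le> y"
      by (intro exI conjI) auto
  qed (use d in simp)
  then show ?thesis unfolding d_def[symmetric] \<gamma>_def[symmetric] by (simp add: algebra_simps)
qed

text \<open>
  An orbit winding infinitely often crosses \<open>w = 0\<close> downwards arbitrarily late, each time above the
  barrier, so that its energy stays bounded; but every crossing adds a fixed amount of energy.
\<close>

lemma angle_bounded_below: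
  assumes above: "\<And>t. t > 0 \<Longrightarrow> p t \<ge> - barrier t"
  shows "\<exists>B. \<forall>t>0. B \<le> \<phi> t"
proof (rule ccontr)
  assume "\<not> ?thesis"
  then have unbounded: "\<exists>t>0. \<phi> t < B" for B by (meson not_le)
  have crossing: "\<exists>s\<ge>T. w s = 0 \<and> p s < 0" if T: "T \<ge> 1" for T
  proof -
    obtain k :: int where k: "of_int (4 * k - 1) * (pi / 2) < \<phi> T"
    proof -
      define k where "k = \<lfloor>\<phi> T / (2 * pi)\<rfloor>"
      have "of_int k \<le> \<phi> T / (2 * pi)" by (simp add: k_def)
      then have "of_int k * (2 * pi) \<le> \<phi> T" by (simp add: field_simps)
      moreover have "of_int (4 * k - 1) * (pi / 2) = of_int k * (2 * pi) - pi / 2"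
        by (simp add: algebra_simps)
      ultimately have "of_int (4 * k - 1) * (pi / 2) < \<phi> T" using pi_gt_zero by linarith
      then show ?thesis using that by blast
    qed
    obtain t where t: "t > 0" "\<phi> t < of_int (4 * k - 1) * (pi / 2)" using unbounded by blast
    then have "t > T" using angle_le[of t "4 * k - 1" T] k by (meson not_le less_imp_le)
    have "\<exists>s. T \<le> s \<and> s \<le> t \<and> \<phi> s = of_int (4 * k - 1) * (pi / 2)"
      using k t \<open>t > T\<close> T by (intro IVT2' continuous_on_subset[OF \<phi>_cont]) auto
    then obtain s where s: "s \<ge> T" "\<phi> s = of_int k * (2 * pi) - pi / 2"
      by (auto simp: algebra_simps)
    have "cos (\<phi> s) = 0" "sin (\<phi> s) = - 1"
      unfolding s cos_diff sin_diff cos_int_period sin_int_period by simp_all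
    then have "w s = 0" "p s \<le> 0"
      using w_polar[of s] p_polar[of s] s T by (simp_all)
    moreover have "p s \<noteq> 0" using R_pos[of s] s T \<open>w s = 0\<close> by auto
    ultimately show ?thesis using s by (intro exI[of _ s]) auto
  qed
  \<comment> \<open>At a crossing \<open>w = 0\<close> the energy is purely kinetic and at least its
    initial value, which bounds the speed there from below by \<open>c\<close>.\<close>
  define c where "c = sqrt (2 * (m * a\<^sup>2))"
  have c: "c > 0" "c\<^sup>2 = 2 * (m * a\<^sup>2)" using m a by (simp_all add: c_def)
  have p_le: "p s \<le> - c" if "s \<ge> 1" "w s = 0" "p s < 0" for s
  proof -
    have "m * a\<^sup>2 \<le> energy s" using energy_0 energy_mono[of 0 s] that by simp
    then have "c\<^sup>2 \<le> (- p s)\<^sup>2" using that by (simp add: energy_def c)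
    then have "c \<le> - p s" by (rule power2_le_imp_le) (use that in simp)
    then show ?thesis by simp
  qed
  have bounded: "energy t \<le> (2 + 4 * m)\<^sup>2 / 2" if t: "t \<ge> 1" for t
  proof -
    obtain s where s: "s \<ge> t" "w s = 0" "p s < 0" using crossing[OF t] by blast
    have "- p s \<le> 2 + 4 * m" using above[of s] barrier_le[of s] s t by linarith
    then have "(- p s)\<^sup>2 \<le> (2 + 4 * m)\<^sup>2" using s by (intro power_mono) auto
    then have "energy s \<le> (2 + 4 * m)\<^sup>2 / 2" using s by (simp add: energy_def)
    then show ?thesis using energy_mono[of t s] s t by linarith
  qed
  define \<gamma> where "\<gamma> = m * tanh 1 * (c / 2)\<^sup>2 * (c / (6 * m))"
  have \<gamma>: "\<gamma> > 0" unfolding \<gamma>_def using m c by (intro mult_pos_pos divide_pos_pos) auto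
  \<comment> \<open>Starting within \<open>\<gamma>\<close> of the supremum, the gain at the next
    crossing would exceed the supremum.\<close>
  define \<Sigma> where "\<Sigma> = (SUP t\<in>{1..}. energy t)"
  have bdd: "bdd_above (energy ` {1..})" using bounded by (auto intro!: bdd_aboveI2[of _ _ "(2 + 4 * m)\<^sup>2 / 2"])
  have "\<exists>t\<in>{1..}. \<Sigma> - \<gamma> < energy t"
    using \<gamma> bdd by (subst less_cSUP_iff[symmetric]) (auto simp: \<Sigma>_def)
  then obtain t where t: "t \<ge> 1" "\<Sigma> - \<gamma> < energy t" by auto
  obtain s where s: "s \<ge> t" "w s = 0" "p s < 0" using crossing[OF t(1)] by blast
  have "energy s + \<gamma> \<le> energy (s + c / (6 * m))"
    using energy_gain[OF c(1) _ p_le] s t by (simp add: \<gamma>_def)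
  also have "\<dots> \<le> \<Sigma>"
    unfolding \<Sigma>_def using s t c m by (intro cSUP_upper bdd) (auto intro!: add_increasing2)
  finally show False using t energy_mono[of t s] s by linarith
qed

text \<open>An angle that is bounded below and passes the axes one way ends up in a single open
  quadrant. The two with \<open>w > 0\<close> are excluded by the uniform rotation rate of
  \<open>angle_rate\<close>, and \<open>w < 0 < p\<close> because \<open>p\<close> would not
  decrease there and \<open>w\<close> would reach 0.\<close>

lemma eventually_falling:
  assumes above: "\<And>t. t > 0 \<Longrightarrow> p t \<ge> - barrier t"
  shows "\<exists>S>0. \<forall>t\<ge>S. w t < 0 \<and> p t < 0"
proof -
  obtain B where B: "\<And>t. t > 0 \<Longrightarrow> B \<le> \<phi> t" using angle_bounded_below[OF above] by blast
  define K where "K = (INF t\<in>{1..}. \<phi> t)"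
  define k where "k = \<lfloor>K / (pi / 2)\<rfloor>"
  have bdd: "bdd_below (\<phi> ` {1..})" using B by (auto intro!: bdd_belowI2[of _ B])
  have "of_int k \<le> K / (pi / 2)" "K / (pi / 2) < of_int k + 1"
    unfolding k_def by linarith+
  then have k: "of_int k * (pi / 2) \<le> K" "K < of_int (k + 1) * (pi / 2)"
    using pi_gt_zero by (simp_all add: field_simps)
  have ge: "of_int k * (pi / 2) \<le> \<phi> t" if "t \<ge> 1" for t
    using cINF_lower[OF bdd, of t] that k by (simp add: K_def)
  have "\<exists>t\<in>{1..}. \<phi> t < of_int (k + 1) * (pi / 2)"
    using k bdd by (subst cINF_less_iff[symmetric]) (auto simp: K_def)
  then obtain T where T: "T \<ge> 1" "\<phi> T < of_int (k + 1) * (pi / 2)" by auto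
  define S where "S = T + 1"
  have S: "S > 0" using T by (simp add: S_def)
  have range: "of_int k * (pi / 2) < \<phi> t" "\<phi> t < of_int (k + 1) * (pi / 2)" if "t \<ge> S" for t
  proof -
    show "\<phi> t < of_int (k + 1) * (pi / 2)"
      using angle_less[of T "k + 1" t] T that by (simp add: S_def)
    \<comment> \<open>Touching the lower end would put the angle strictly below its infimum one time
      unit later.\<close>
    show "of_int k * (pi / 2) < \<phi> t"
      using ge[of t] angle_less[of t k "t + 1"] ge[of "t + 1"] that T by (force simp: S_def)
  qed
  define j where "j = k div 4"
  define i where "i = k mod 4"
  have kij: "of_int k = 4 * of_int j + (of_int i :: real)"
    unfolding j_def i_def by (metis mult_div_mod_eq of_int_add of_int_mult of_int_numeral)
  have i: "i = 0 \<or> i = 1 \<or> i = 2 \<or> i = 3" unfolding i_def by presburger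
  define \<psi> where "\<psi> t = \<phi> t - of_int j * (2 * pi)" for t
  have \<psi>_range: "of_int i * (pi / 2) < \<psi> t" "\<psi> t < (of_int i + 1) * (pi / 2)" if "t \<ge> S" for t
    using range[OF that] by (simp_all add: \<psi>_def kij algebra_simps)
  have trig: "cos (\<phi> t) = cos (\<psi> t)" "sin (\<phi> t) = sin (\<psi> t)" for t
    unfolding \<psi>_def cos_diff sin_diff cos_int_period sin_int_period by simp_all
  have signs: "(w t > 0 \<longleftrightarrow> cos (\<psi> t) > 0)" "(w t < 0 \<longleftrightarrow> cos (\<psi> t) < 0)"
     "(p t > 0 \<longleftrightarrow> sin (\<psi> t) > 0)" "(p t < 0 \<longleftrightarrow> sin (\<psi> t) < 0)" if "t \<ge> S" for t
    using angle_signs[of t] that S unfolding trig by simp_all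
  have not_right: False if "\<And>t. t \<ge> S \<Longrightarrow> w t > 0"
  proof -
    define t where "t = S + 50 * (\<phi> S - B + 1)"
    have tS: "t \<ge> S" using B[OF S] by (simp add: t_def)
    have "\<phi> t + 1/50 * t \<le> \<phi> S + 1/50 * S"
    proof (rule DERIV_nonpos_imp_nonincreasing[where f = "\<lambda>t. \<phi> t + 1/50 * t", OF tS])
      fix r assume r: "S \<le> r" "r \<le> t"
      have "w r \<ge> - 1/15" using that[OF r(1)] by simp
      then obtain d where d: "d \<le> - 1/50" "(\<phi> has_real_derivative d) (at r)"
        using angle_rate[of r] r S by auto
      show "\<exists>y. ((\<lambda>t. \<phi> t + 1/50 * t) has_real_derivative y) (at r) \<and> y \<le> 0"
        using d by (intro exI[of _ "d + 1/50"]) (auto intro!: derivative_eq_intros)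
    qed
    then have "\<phi> t < B" by (simp add: t_def field_simps)
    then show False using B[of t] tS S by simp
  qed
  have not_rising: False if left: "\<And>t. t \<ge> S \<Longrightarrow> w t < 0 \<and> p t > 0"
  proof -
    have p_ge: "p S \<le> p t" if "t \<ge> S" for t
    proof (rule DERIV_nonneg_imp_nondecreasing[OF that])
      fix r assume r: "S \<le> r" "r \<le> t"
      have "trunc_exp (w r) \<le> 1" using left[of r] r by (simp add: trunc_exp_eq)
      then have "2 * m * (trunc_exp (w r) - 1) \<le> 0" using m by (intro mult_nonneg_nonpos) auto
      moreover have "m * tanh r * p r \<ge> 0" using left[of r] r m S by simp
      ultimately show "\<exists>y. (p has_real_derivative y) (at r) \<and> 0 \<le> y"
        using p'[of r] r S
        by (intro exI[of _ "m * tanh r * p r - 2 * m * (trunc_exp (w r) - 1)"] conjI) auto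
    qed
    define t where "t = S + (- w S) / p S"
    have tS: "t \<ge> S" using left[of S] by (simp add: t_def divide_nonpos_pos)
    have "w S - p S * S \<le> w t - p S * t"
    proof (rule DERIV_nonneg_imp_nondecreasing[where f = "\<lambda>t. w t - p S * t", OF tS])
      fix r assume r: "S \<le> r" "r \<le> t"
      show "\<exists>y. ((\<lambda>t. w t - p S * t) has_real_derivative y) (at r) \<and> 0 \<le> y"
        using p_ge[of r] r S w'[of r] by (intro exI[of _ "p r - p S"]) (auto intro!: derivative_eq_intros)
    qed
    then have "w t \<ge> 0" using left[of S] by (simp add: t_def field_simps)
    then show False using left[OF tS] by simp
  qed
  from i consider "i = 0" | "i = 1" | "i = 2" | "i = 3" by blast
  then show ?thesis
  proof cases
    case 1
    have "cos (\<psi> t) > 0" if "t \<ge> S" for t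
      using \<psi>_range[OF that] 1 by (intro cos_gt_zero_pi) auto
    then show ?thesis using not_right signs by blast
  next
    case 2
    have "cos (\<psi> t) < 0 \<and> sin (\<psi> t) > 0" if "t \<ge> S" for t
      using \<psi>_range[OF that] 2 cos_gt_zero_pi[of "\<psi> t - pi"] by (auto intro!: sin_gt_zero)
    then show ?thesis using not_rising signs by blast
  next
    case 3
    have "cos (\<psi> t) < 0 \<and> sin (\<psi> t) < 0" if "t \<ge> S" for t
      using \<psi>_range[OF that] 3 cos_gt_zero_pi[of "\<psi> t - pi"] by (auto intro!: sin_lt_zero)
    then show ?thesis using signs S by blast
  next
    case 4
    have "cos (\<psi> t) > 0" if "t \<ge> S" for t
    proof -
      have "cos (\<psi> t - 2 * pi) > 0"
        using \<psi>_range[OF that] 4 by (intro cos_gt_zero_pi) auto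
      then show ?thesis by (simp add: cos_diff)
    qed
    then show ?thesis using not_right signs by blast
  qed
qed

text \<open>The upper end is a one-way gate, and at the lower end \<open>p\<close> would vanish,
  whereas \<open>p < - 2\<close> below the barrier.\<close>

lemma falling_window_stays:
  assumes s: "s > 0" "p s < - barrier s" and window: "\<phi> s \<in> falling_window k" and t: "t \<ge> s"
  shows "\<phi> t \<in> falling_window k"
proof -
  have p_less: "p r < - 2" if "r \<ge> s" for r
    using below_barrier[OF s that] barrier_ge[of r] by simp
  have "\<phi> t < of_int (4 * k - 1) * (pi / 2)"
    using angle_less[of s "4 * k - 1" t] window s t by (cases "t = s") (auto simp: falling_window_def)
  moreover have "of_int (4 * k - 2) * (pi / 2) < \<phi> t"
  proof (rule ccontr)
    assume "\<not> ?thesis"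
    then have "\<exists>r. s \<le> r \<and> r \<le> t \<and> \<phi> r = of_int (4 * k - 2) * (pi / 2)"
      using window t s unfolding falling_window_def
      by (intro IVT2' continuous_on_subset[OF \<phi>_cont]) auto
    then obtain r where r: "r \<ge> s" "\<phi> r = of_int (2 * k - 1) * pi"
      by (auto simp: algebra_simps)
    then have "sin (\<phi> r) = 0" unfolding r(2) sin_zero_iff_int2 by blast
    then show False using angle_signs(4)[of r] p_less[OF r(1)] r s by simp
  qed
  ultimately show ?thesis by (simp add: falling_window_def)
qed

lemma below_barrier_window:
  assumes s: "s > 0" "p s < - barrier s"
  shows "\<exists>k S. S > 0 \<and> p S < - barrier S \<and> \<phi> S \<in> falling_window k"
proof -
  have p_less: "p t < - 2" if "t \<ge> s" for t
    using below_barrier[OF s that] barrier_ge[of t] by simp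
  define S where "S = s + (\<bar>w s\<bar> + 1)"
  have S: "S \<ge> s" "S > 0" using s by (simp_all add: S_def)
  have "w S + 1 * S \<le> w s + 1 * s"
  proof (rule DERIV_nonpos_imp_nonincreasing[where f = "\<lambda>t. w t + 1 * t"])
    fix r assume r: "s \<le> r" "r \<le> S"
    show "\<exists>y. ((\<lambda>t. w t + 1 * t) has_real_derivative y) (at r) \<and> y \<le> 0"
      using p_less[of r] r s w'[of r] by (intro exI[of _ "p r + 1"]) (auto intro!: derivative_eq_intros)
  qed (use S in simp)
  then have "w S < 0" by (simp add: S_def)
  then have neg: "cos (\<phi> S) < 0" "sin (\<phi> S) < 0"
    using angle_signs[of S] p_less[of S] S by simp_all
  \<comment> \<open>The index of the full turn from \<open>2 * pi * k - 3 * pi / 2\<close> to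
    \<open>2 * pi * k + pi / 2\<close> that contains \<open>\<phi> S\<close>, as
    \<open>falling_windowI\<close> requires.\<close>
  define k where "k = \<lfloor>(\<phi> S + 3 * pi / 2) / (2 * pi)\<rfloor>"
  have "of_int k \<le> (\<phi> S + 3 * pi / 2) / (2 * pi)" "(\<phi> S + 3 * pi / 2) / (2 * pi) < of_int k + 1"
    unfolding k_def by linarith+
  then have "of_int (4 * k - 3) * (pi / 2) \<le> \<phi> S" "\<phi> S < of_int (4 * k + 1) * (pi / 2)"
    using pi_gt_zero by (simp_all add: field_simps)
  then have "\<phi> S \<in> falling_window k" using neg by (intro falling_windowI)
  then show ?thesis using S below_barrier[OF s S(1)] by blast
qed

end

section \<open>Regularity at the poles\<close>

text \<open>With \<open>e\<close> the tail integral of the bound, \<open>V - e\<close> is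
  nondecreasing and \<open>V + e\<close> nonincreasing, so \<open>V - e\<close> is bounded above and
  converges, while \<open>e\<close> tends to 0.\<close>

lemma convergent_at_top_exp_deriv:
  fixes V :: "real \<Rightarrow> real"
  assumes \<eta>: "\<eta> > 0"
    and deriv: "\<And>t. t \<ge> S \<Longrightarrow> (V has_real_derivative U t) (at t)"
    and U: "\<And>t. t \<ge> S \<Longrightarrow> \<bar>U t\<bar> \<le> C * exp (- \<eta> * t)"
  shows "\<exists>l. (V \<longlongrightarrow> l) at_top"
proof -
  define e where "e t = C / \<eta> * exp (- \<eta> * t)" for t
  have e': "(e has_real_derivative - (C * exp (- \<eta> * t))) (at t)" for t
    unfolding e_def using \<eta> by (auto intro!: derivative_eq_intros)
  have up: "V s - e s \<le> V t - e t" if "S \<le> s" "s \<le> t" for s t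
  proof (rule DERIV_nonneg_imp_nondecreasing[where f = "\<lambda>t. V t - e t", OF that(2)])
    fix r assume "s \<le> r" "r \<le> t"
    then show "\<exists>y. ((\<lambda>t. V t - e t) has_real_derivative y) (at r) \<and> 0 \<le> y"
      using U[of r] that
      by (intro exI[of _ "U r + C * exp (- \<eta> * r)"])
        (auto intro!: derivative_eq_intros deriv e')
  qed
  have down: "V t + e t \<le> V s + e s" if "S \<le> s" "s \<le> t" for s t
  proof (rule DERIV_nonpos_imp_nonincreasing[where f = "\<lambda>t. V t + e t", OF that(2)])
    fix r assume "s \<le> r" "r \<le> t"
    then show "\<exists>y. ((\<lambda>t. V t + e t) has_real_derivative y) (at r) \<and> y \<le> 0"
      using U[of r] that
      by (intro exI[of _ "U r - C * exp (- \<eta> * r)"])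
        (auto intro!: derivative_eq_intros deriv e')
  qed
  have "0 \<le> \<bar>U S\<bar>" by simp
  also have "\<dots> \<le> C * exp (- \<eta> * S)" by (rule U) simp
  finally have C: "C \<ge> 0" by (simp add: zero_le_mult_iff)
  have e0: "e t \<ge> 0" for t using C \<eta> by (simp add: e_def)
  define l where "l = (SUP t\<in>{S..}. V t - e t)"
  have bdd: "bdd_above ((\<lambda>t. V t - e t) ` {S..})"
    using down[of S] e0 by (intro bdd_aboveI2[of _ _ "V S + e S"]) (smt (verit) atLeast_iff)
  have "((\<lambda>t. V t - e t) \<longlongrightarrow> l) at_top"
  proof (rule increasing_tendsto)
    show "\<forall>\<^sub>F t in at_top. V t - e t \<le> l"
      unfolding l_def using eventually_ge_at_top[of S]
      by eventually_elim (auto intro!: cSUP_upper bdd)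
    fix x assume "x < l"
    then obtain s where s: "s \<ge> S" "x < V s - e s"
      unfolding l_def by (subst (asm) less_cSUP_iff) (use bdd in auto)
    show "\<forall>\<^sub>F t in at_top. x < V t - e t"
      using eventually_ge_at_top[of s] by eventually_elim (use s up in fastforce)
  qed
  moreover have "(e \<longlongrightarrow> C / \<eta> * 0) at_top"
    unfolding e_def using \<eta> by (intro tendsto_intros) real_asymp
  ultimately have "((\<lambda>t. (V t - e t) + e t) \<longlongrightarrow> l + C / \<eta> * 0) at_top"
    by (rule tendsto_add)
  then show ?thesis by auto
qed

lemma cosh_real_le_exp: "t \<ge> 0 \<Longrightarrow> cosh t \<le> exp (t :: real)"
  using cosh_plus_sinh[of t] sinh_real_nonneg_iff[of t] by linarith

lemma exp_le_cosh_real: "exp t \<le> 2 * cosh (t :: real)"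
  by (simp add: cosh_def)

lemma sech_square: "1 - (tanh t)\<^sup>2 = 1 / (cosh (t :: real))\<^sup>2"
  by (simp add: tanh_def power_divide cosh_square_eq divide_simps add_nonneg_eq_0_iff)

text \<open>The rate 5/2 lies between 2, the growth rate of the factor
  \<open>(cosh t)\<^sup>2\<close> in \<open>P\<close> and \<open>Q\<close>, and
  \<open>m + 2 \<ge> 3\<close>, the smaller of the two repulsion rates of their equations.\<close>

lemma cosh_square_exp_tendsto_0: "((\<lambda>t :: real. (cosh t)\<^sup>2 * exp (- (5/2) * t)) \<longlongrightarrow> 0) at_top"
proof (rule Lim_null_comparison)
  show "((\<lambda>t :: real. exp (- (1/2) * t)) \<longlongrightarrow> 0) at_top" by real_asymp
  show "\<forall>\<^sub>F t :: real in at_top. norm ((cosh t)\<^sup>2 * exp (- (5/2) * t)) \<le> exp (- (1/2) * t)"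
    using eventually_ge_at_top[of 0]
  proof eventually_elim
    fix t :: real assume t: "t \<ge> 0"
    have "(cosh t)\<^sup>2 * exp (- (5/2) * t) \<le> (exp t)\<^sup>2 * exp (- (5/2) * t)"
      using cosh_real_le_exp[OF t] by (intro mult_right_mono power_mono) auto
    also have "\<dots> = exp (- (1/2) * t)"
      by (simp add: power2_eq_square exp_add[symmetric])
    finally show "norm ((cosh t)\<^sup>2 * exp (- (5/2) * t)) \<le> exp (- (1/2) * t)" by simp
  qed
qed

section \<open>Decay of orbits above the barrier and limits at the pole\<close>

context shooting_orbit
begin

text \<open>An orbit with \<open>w > 0\<close> must later cross \<open>w = 0\<close> downwards
  because it eventually falls. There the barrier bounds the energy by \<open>30\<^sup>2 / 2\<close>;
  energy never decreases, so the bound holds earlier too and controls \<open>w\<close>.\<close>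

lemma w_le_30:
  assumes above: "\<And>t. t > 0 \<Longrightarrow> p t \<ge> - barrier t" and t: "t \<ge> 0"
  shows "w t \<le> 30"
proof (cases "w t \<le> 0")
  case False
  obtain S where S: "S > 0" "\<And>t. t \<ge> S \<Longrightarrow> w t < 0 \<and> p t < 0"
    using eventually_falling[OF above] by blast
  have "t < S" using S(2)[of t] False by force
  obtain r where r: "r \<ge> t" "w r = 0" "p r \<le> 0"
  proof (rule ccontr)
    assume *: "\<not> thesis"
    have "- w S \<le> 0"
    proof (rule downward_barrier[where u = "\<lambda>t. - w t"])
      show "continuous_on {t..S} (\<lambda>t. - w t)"
        using t by (intro continuous_intros continuous_on_subset[OF w_cont]) auto
      fix r assume r: "t \<le> r" "r < S" "- w r = 0"
      have "r > 0" using r t False by (cases "r = 0") auto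
      then have "((\<lambda>t. - w t) has_real_derivative - p r) (at r)"
        by (auto intro!: derivative_eq_intros w')
      moreover have "p r > 0" using * that r by force
      ultimately show "\<exists>d<0. ((\<lambda>t. - w t) has_real_derivative d) (at r)"
        by (intro exI[of _ "- p r"]) simp
    qed (use False \<open>t < S\<close> in auto)
    then show False using S(2)[of S] by simp
  qed
  have "r > 0" using r t False by (cases "r = 0") auto
  have "- p r \<le> 2 + 4 * m" using above[of r] barrier_le[of r] \<open>r > 0\<close> by linarith
  then have "(- p r)\<^sup>2 \<le> 30\<^sup>2" using r m by (intro power_mono) auto
  then have "energy t \<le> 30\<^sup>2 / 2"
    using energy_mono[of t r] r t by (simp add: energy_def)
  moreover have "2 * m * trunc_pot (w t) \<le> energy t" by (simp add: energy_def)
  moreover have "m * (w t)\<^sup>2 \<le> 2 * m * trunc_pot (w t)"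
    using mult_left_mono[OF trunc_pot_ge[of "w t"], of "2 * m"] False m by simp
  moreover have "1 * (w t)\<^sup>2 \<le> m * (w t)\<^sup>2" using m by (intro mult_right_mono) auto
  ultimately have "(w t)\<^sup>2 \<le> 30\<^sup>2" by simp
  then show ?thesis by (rule power2_le_imp_le) simp
qed simp

text \<open>Once falling, \<open>w \<le> w S\<close>, so the restoring force exceeds
  \<open>2 * m * \<eta>\<close> or equals it. If ever \<open>p > - \<eta>\<close>, the force beats
  the anti-damping, \<open>p\<close> has slope at least \<open>m * \<eta>\<close> and reaches 0,
  contradicting the fall.\<close>

lemma exponential_fall:
  assumes above: "\<And>t. t > 0 \<Longrightarrow> p t \<ge> - barrier t"
  shows "\<exists>\<eta> C S. 0 < \<eta> \<and> \<eta> < 1 \<and> 0 < S \<and> 0 < C \<and> (\<forall>t\<ge>S. exp (w t) \<le> C * exp (- \<eta> * t) \<and> p t < 0)"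
proof -
  obtain S where S: "S > 0" "\<And>t. t \<ge> S \<Longrightarrow> w t < 0 \<and> p t < 0"
    using eventually_falling[OF above] by blast
  define \<eta> where "\<eta> = 1 - exp (w S)"
  have \<eta>: "0 < \<eta>" "\<eta> < 1" using S(2)[of S] by (simp_all add: \<eta>_def)
  have w_le: "w t \<le> w S" if "t \<ge> S" for t
  proof (rule DERIV_nonpos_imp_nonincreasing[OF that])
    fix r assume r: "S \<le> r" "r \<le> t"
    then show "\<exists>y. (w has_real_derivative y) (at r) \<and> y \<le> 0"
      using S(2)[OF r(1)] w'[of r] S(1) by (intro exI[of _ "p r"]) auto
  qed
  define q where "q t = m * tanh t * p t - 2 * m * (trunc_exp (w t) - 1)" for t
  have q: "q t \<ge> m * \<eta>" if "t \<ge> S" "p t \<ge> - \<eta>" for t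
  proof -
    have "trunc_exp (w t) \<le> 1 - \<eta>"
      using w_le[OF that(1)] S(2)[OF that(1)] by (simp add: trunc_exp_eq \<eta>_def)
    then have "2 * m * (trunc_exp (w t) - 1) \<le> 2 * m * (- \<eta>)"
      using m by (intro mult_left_mono) auto
    moreover have "tanh t * (- p t) \<le> 1 * \<eta>"
      using that S(2)[OF that(1)] S(1) tanh_real_lt_1[of t] by (intro mult_mono) auto
    then have "m * (tanh t * (- p t)) \<le> m * \<eta>" using m by (intro mult_left_mono) auto
    ultimately show ?thesis by (simp add: q_def algebra_simps)
  qed
  have p_le: "p t \<le> - \<eta>" if t: "t \<ge> S" for t
  proof (rule ccontr)
    assume "\<not> p t \<le> - \<eta>"
    have p_ge: "p r \<ge> p t" if "r \<ge> t" for r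
    proof -
      have "- p r \<le> - p t"
      proof (rule downward_barrier[where u = "\<lambda>t. - p t", OF _ order_refl _ that])
        show "continuous_on {t..r} (\<lambda>t. - p t)"
          using t S(1) by (intro continuous_intros continuous_on_subset[OF p_cont]) auto
        fix s assume s: "t \<le> s" "s < r" "- p s = - p t"
        have "q s \<ge> m * \<eta>" using q[of s] s t \<open>\<not> p t \<le> - \<eta>\<close> by simp
        moreover have "m * \<eta> > 0" using m \<eta> by simp
        ultimately have "- q s < 0" by linarith
        moreover have "((\<lambda>t. - p t) has_real_derivative - q s) (at s)"
          unfolding q_def using s t S(1) by (auto intro!: derivative_eq_intros p')
        ultimately show "\<exists>d<0. ((\<lambda>t. - p t) has_real_derivative d) (at s)" by blast
      qed
      then show ?thesis by simp
    qed
    define r where "r = t + (- p t) / (m * \<eta>)"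
    have m\<eta>: "m * \<eta> > 0" using m \<eta> by simp
    have tr: "t \<le> r" using S(2)[OF t] m\<eta> by (simp add: r_def divide_nonpos_pos)
    have "p t - m * \<eta> * t \<le> p r - m * \<eta> * r"
    proof (rule DERIV_nonneg_imp_nondecreasing[where f = "\<lambda>t. p t - m * \<eta> * t", OF tr])
      fix s assume s: "t \<le> s" "s \<le> r"
      have "q s \<ge> m * \<eta>" using q[of s] p_ge[of s] s t \<open>\<not> p t \<le> - \<eta>\<close> by simp
      moreover have "(p has_real_derivative q s) (at s)"
        unfolding q_def using s t S(1) by (intro p') auto
      ultimately show "\<exists>y. ((\<lambda>t. p t - m * \<eta> * t) has_real_derivative y) (at s) \<and> 0 \<le> y"
        by (intro exI[of _ "q s - m * \<eta>"]) (auto intro!: derivative_eq_intros)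
    qed
    moreover have "K * (t + (- x) / K) = K * t - x" if "K > 0" for K x :: real
      using that by (simp add: field_simps)
    from this[OF m\<eta>] have "m * \<eta> * r = m * \<eta> * t - p t"
      unfolding r_def .
    ultimately have "p r \<ge> 0" by linarith
    then show False using S(2)[of r] t tr by simp
  qed
  have "exp (w t) \<le> exp (\<eta> * S) * exp (- \<eta> * t) \<and> p t < 0" if t: "t \<ge> S" for t
  proof -
    have "w t + \<eta> * t \<le> w S + \<eta> * S"
    proof (rule DERIV_nonpos_imp_nonincreasing[where f = "\<lambda>t. w t + \<eta> * t", OF t])
      fix r assume r: "S \<le> r" "r \<le> t"
      then show "\<exists>y. ((\<lambda>t. w t + \<eta> * t) has_real_derivative y) (at r) \<and> y \<le> 0"
        using p_le[OF r(1)] w'[of r] S(1)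
        by (intro exI[of _ "p r + \<eta>"]) (auto intro!: derivative_eq_intros)
    qed
    then have "w t \<le> \<eta> * S + (- \<eta> * t)" using S(2)[of S] by simp
    then show ?thesis using S(2)[OF t] by (simp only: exp_add[symmetric] exp_le_cancel_iff)
  qed
  then show ?thesis using \<eta> S(1) by (intro exI[of _ \<eta>] exI[of _ "exp (\<eta> * S)"] exI[of _ S]) auto
qed

text \<open>The sought solution in the Mercator coordinate: \<open>sin \<theta> = 1 / cosh t\<close>
  turns \<open>- 2 * ln (sin \<theta>)\<close> into \<open>2 * ln (cosh t)\<close>.\<close>

definition V :: "real \<Rightarrow> real" where
  "V t = w t + 2 * ln (cosh t) + ln (m / (m + 1))"

definition U :: "real \<Rightarrow> real" where
  "U t = p t + 2 * tanh t"

text \<open>Minus the zeroth-order term of the equation, since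
  \<open>2 * (m + 1) = 2 * (N - 2)\<close>.\<close>

definition F :: "real \<Rightarrow> real" where
  "F t = 2 * (m + 1) * (1 - exp (V t))"

text \<open>\<open>P\<close> and \<open>Q\<close> are the first and second derivative of \<open>V\<close> with respect to \<open>tanh t = cos \<theta>\<close>.\<close>

definition P :: "real \<Rightarrow> real" where
  "P t = (cosh t)\<^sup>2 * U t"

definition Q :: "real \<Rightarrow> real" where
  "Q t = (cosh t)\<^sup>2 * ((m + 2) * tanh t * P t + F t)"

lemma V_cont: "continuous_on {0..} V"
  unfolding V_def by (intro continuous_intros w_cont) (auto simp: less_imp_neq[OF cosh_real_pos, symmetric])

lemma U_cont: "continuous_on {0..} U"
  unfolding U_def by (intro continuous_intros p_cont) auto

lemma P_cont: "continuous_on {0..} P"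
  unfolding P_def by (intro continuous_intros U_cont)

lemma Q_cont: "continuous_on {0..} Q"
  unfolding Q_def F_def by (intro continuous_intros P_cont V_cont) auto

lemma V_deriv: "t > 0 \<Longrightarrow> (V has_real_derivative U t) (at t)"
  unfolding V_def U_def by (auto intro!: derivative_eq_intros w' simp: tanh_def)

lemma exp_V: "exp (V t) = exp (w t) * (cosh t)\<^sup>2 * (m / (m + 1))"
  using m by (simp add: V_def exp_add exp_double)

lemma F_sech: "F t / (cosh t)\<^sup>2 = 2 * (m + 1) * (1 / (cosh t)\<^sup>2) - 2 * m * exp (w t)"
proof -
  have "2 * (m + 1) * (1 - e * c * k) / c = 2 * (m + 1) * (1 / c) - 2 * ((m + 1) * k) * e"
    if "c > 0" for c e k :: real
    using that by (simp add: field_simps)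
  from this[of "(cosh t)\<^sup>2" "exp (w t)" "m / (m + 1)"] show ?thesis
    using m by (simp add: F_def exp_V)
qed

lemma U_deriv:
  assumes t: "t > 0" and w: "w t \<le> 30"
  shows "(U has_real_derivative m * tanh t * U t + F t / (cosh t)\<^sup>2) (at t)"
proof -
  have "(U has_real_derivative m * tanh t * p t - 2 * m * (exp (w t) - 1) + 2 * (1 - (tanh t)\<^sup>2)) (at t)"
    unfolding U_def using t w by (auto intro!: derivative_eq_intros p' simp: trunc_exp_eq)
  moreover have "F t / (cosh t)\<^sup>2 = 2 * (m + 1) * (1 - (tanh t)\<^sup>2) - 2 * m * exp (w t)"
    by (simp only: sech_square F_sech)
  then have "m * tanh t * p t - 2 * m * (exp (w t) - 1) + 2 * (1 - (tanh t)\<^sup>2) =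
      m * tanh t * U t + F t / (cosh t)\<^sup>2"
    by (simp add: U_def algebra_simps power2_eq_square)
  ultimately show ?thesis by simp
qed

lemma P_deriv:
  assumes t: "t > 0" and w: "w t \<le> 30"
  shows "(P has_real_derivative (m + 2) * tanh t * P t + F t) (at t)"
proof -
  have "(P has_real_derivative 2 * cosh t * sinh t * U t + (cosh t)\<^sup>2 * (m * tanh t * U t + F t / (cosh t)\<^sup>2)) (at t)"
    unfolding P_def by (auto intro!: derivative_eq_intros U_deriv[OF t w])
  moreover have "2 * cosh t * sinh t * U t = 2 * tanh t * P t"
    by (simp add: P_def tanh_def power2_eq_square)
  moreover have "(cosh t)\<^sup>2 * (m * tanh t * U t + F t / (cosh t)\<^sup>2) = m * tanh t * P t + F t"
    by (simp add: P_def distrib_left mult_ac)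
  ultimately have "(P has_real_derivative 2 * tanh t * P t + (m * tanh t * P t + F t)) (at t)"
    by (simp only:)
  then show ?thesis by (rule DERIV_cong) (simp add: algebra_simps)
qed

lemma F_deriv:
  assumes t: "t > 0"
  shows "(F has_real_derivative - 2 * (m + 1) * exp (V t) * U t) (at t)"
  unfolding F_def by (auto intro!: derivative_eq_intros V_deriv[OF t] simp: algebra_simps)

lemma Q_deriv:
  assumes t: "t > 0" and w: "w t \<le> 30"
  shows "(Q has_real_derivative (m + 4) * tanh t * Q t + ((m + 2) - 2 * (m + 1) * exp (V t)) * P t) (at t)"
proof -
  let ?A = "(m + 2) * tanh t * P t + F t"
  have "(Q has_real_derivative 2 * cosh t * sinh t * ?A +
      (cosh t)\<^sup>2 * ((m + 2) * ((1 - (tanh t)\<^sup>2) * P t + tanh t * ?A) - 2 * (m + 1) * exp (V t) * U t)) (at t)"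
    unfolding Q_def
    by (auto intro!: derivative_eq_intros P_deriv[OF t w] F_deriv[OF t] simp: algebra_simps)
  moreover have "2 * cosh t * sinh t * ?A = 2 * tanh t * Q t"
    by (simp add: Q_def tanh_def power2_eq_square)
  moreover have "(cosh t)\<^sup>2 * ((m + 2) * ((1 - (tanh t)\<^sup>2) * P t + tanh t * ?A) - 2 * (m + 1) * exp (V t) * U t) =
      (m + 2) * ((cosh t)\<^sup>2 * (1 - (tanh t)\<^sup>2)) * P t + (m + 2) * tanh t * ((cosh t)\<^sup>2 * ?A)
        - 2 * (m + 1) * exp (V t) * ((cosh t)\<^sup>2 * U t)"
    by (simp only: algebra_simps)
  moreover have "(cosh t)\<^sup>2 * (1 - (tanh t)\<^sup>2) = 1" by (simp add: sech_square)
  moreover have "(cosh t)\<^sup>2 * ?A = Q t" "(cosh t)\<^sup>2 * U t = P t" by (simp_all add: Q_def P_def)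
  ultimately have "(Q has_real_derivative 2 * tanh t * Q t +
      ((m + 2) * 1 * P t + (m + 2) * tanh t * Q t - 2 * (m + 1) * exp (V t) * P t)) (at t)"
    by (simp only:)
  then show ?thesis by (rule DERIV_cong) (simp add: algebra_simps)
qed

text \<open>\<open>U\<close> solves an unstable equation with exponentially small forcing
  \<open>g\<close>. Being above the barrier bounds \<open>U\<close>, which rules out the growing
  mode, so \<open>U\<close> decays like the forcing; in particular \<open>p\<close> tends to
  -2.\<close>

lemma U_exponential_bound:
  assumes above: "\<And>t. t > 0 \<Longrightarrow> p t \<ge> - barrier t"
  shows "\<exists>\<eta> C S. 0 < \<eta> \<and> 0 < S \<and> (\<forall>t\<ge>S. \<bar>U t\<bar> \<le> C * exp (- \<eta> * t))"
proof -
  obtain \<eta> C S where \<eta>: "0 < \<eta>" "\<eta> < 1" and S: "0 < S" and C: "0 < C"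
    and fall: "\<And>t. t \<ge> S \<Longrightarrow> exp (w t) \<le> C * exp (- \<eta> * t) \<and> p t < 0"
    using exponential_fall[OF above] by blast
  define D where "D = 8 * (m + 1) + 2 * m * C"
  have D: "D > 0" using m C by (simp add: D_def add_pos_pos)
  define g where "g t = F t / (cosh t)\<^sup>2" for t
  have g_le: "\<bar>g t\<bar> \<le> D * exp (- \<eta> * t)" if t: "t \<ge> S" for t
  proof -
    have "1 / (cosh t)\<^sup>2 \<le> 4 * exp (- \<eta> * t)"
    proof -
      have "(exp t)\<^sup>2 \<le> (2 * cosh t)\<^sup>2" using exp_le_cosh_real by (intro power_mono) auto
      then have "1 / (cosh t)\<^sup>2 \<le> 4 / (exp t)\<^sup>2" by (simp add: field_simps power_mult_distrib)
      also have "\<dots> = 4 * exp (- (2 * t))" unfolding exp_minus exp_double by (simp add: divide_inverse)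
      also have "\<dots> \<le> 4 * exp (- \<eta> * t)"
        using mult_right_mono[of \<eta> 2 t] \<eta> S t by simp
      finally show ?thesis .
    qed
    then have "2 * (m + 1) * (1 / (cosh t)\<^sup>2) \<le> 2 * (m + 1) * (4 * exp (- \<eta> * t))"
      using m by (intro mult_left_mono) auto
    moreover have "2 * m * exp (w t) \<le> 2 * m * (C * exp (- \<eta> * t))"
      using m fall[OF t] by (intro mult_left_mono) auto
    moreover have "2 * (m + 1) * (1 / (cosh t)\<^sup>2) \<ge> 0" "2 * m * exp (w t) \<ge> 0" using m by auto
    moreover have "g t = 2 * (m + 1) * (1 / (cosh t)\<^sup>2) - 2 * m * exp (w t)"
      by (simp only: g_def F_sech)
    moreover have "D * exp (- \<eta> * t) = 2 * (m + 1) * (4 * exp (- \<eta> * t)) + 2 * m * (C * exp (- \<eta> * t))"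
      by (simp add: D_def algebra_simps)
    ultimately show ?thesis by linarith
  qed
  have U_abs: "\<bar>U t\<bar> \<le> 4 + 4 * m" if t: "t \<ge> S" for t
  proof -
    have "- p t \<le> 2 + 4 * m" using above[of t] barrier_le[of t] S t by linarith
    moreover have "0 \<le> tanh t" "tanh t \<le> 1" using S t tanh_real_lt_1[of t] by auto
    moreover have "p t < 0" using fall[OF t] by blast
    ultimately show ?thesis using m unfolding U_def by linarith
  qed
  have "((\<lambda>t. m * tanh t) \<longlongrightarrow> m * 1) at_top" by (intro tendsto_intros tanh_real_at_top)
  then have "\<forall>\<^sub>F t in at_top. m * tanh t > 1/2" using m by (intro order_tendstoD(1)) auto
  then obtain S1 where S1: "\<And>t. t \<ge> S1 \<Longrightarrow> m * tanh t > 1/2"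
    unfolding eventually_at_top_linorder by blast
  define T where "T = max S S1"
  \<comment> \<open>The sign \<open>\<sigma>\<close> treats both directions at once. The derivative
    of the subtracted term adds \<open>D * exp (- \<eta> * t)\<close>, exactly enough to absorb
    \<open>g\<close>.\<close>
  have bound: "\<sigma> * U t - D / \<eta> * exp (- \<eta> * t) \<le> 0" if \<sigma>: "\<sigma> = 1 \<or> \<sigma> = - 1" and "t > T" for \<sigma> t
  proof (rule unstable_bound[OF _ _ _ _ \<open>t > T\<close>])
    show "(0 :: real) < 1/2" by simp
    fix t assume t: "t > T"
    have t': "t > 0" "t \<ge> S" "t \<ge> S1" using t S by (auto simp: T_def)
    have w: "w t \<le> 30" using w_le_30[OF above, of t] t' by simp
    show "((\<lambda>t. \<sigma> * U t - D / \<eta> * exp (- \<eta> * t)) has_real_derivative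
        \<sigma> * (m * tanh t * U t + g t) + D * exp (- \<eta> * t)) (at t)"
      unfolding g_def using \<eta> by (auto intro!: derivative_eq_intros U_deriv[OF t'(1) w])
    assume pos: "\<sigma> * U t - D / \<eta> * exp (- \<eta> * t) > 0"
    have "1/2 * (\<sigma> * U t - D / \<eta> * exp (- \<eta> * t)) \<le> (m * tanh t) * (\<sigma> * U t - D / \<eta> * exp (- \<eta> * t))"
      using pos S1[OF t'(3)] by (intro mult_right_mono) auto
    also have "\<dots> \<le> m * tanh t * (\<sigma> * U t)"
      using m t' \<eta> D by (simp add: right_diff_distrib)
    also have "\<dots> \<le> \<sigma> * (m * tanh t * U t + g t) + D * exp (- \<eta> * t)"
      using g_le[OF t'(2)] \<sigma> by (auto simp: algebra_simps abs_le_iff)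
    finally show "1/2 * (\<sigma> * U t - D / \<eta> * exp (- \<eta> * t)) \<le> \<sigma> * (m * tanh t * U t + g t) + D * exp (- \<eta> * t)" .
  next
    have "((\<lambda>t. U t * exp (- (1/2) * t)) \<longlongrightarrow> 0) at_top"
    proof (rule Lim_null_comparison)
      show "((\<lambda>t. (4 + 4 * m) * exp (- (1/2) * t)) \<longlongrightarrow> 0) at_top" by real_asymp
      show "\<forall>\<^sub>F t in at_top. norm (U t * exp (- (1/2) * t)) \<le> (4 + 4 * m) * exp (- (1/2) * t)"
        using eventually_ge_at_top[of S]
        by eventually_elim (use U_abs in \<open>auto simp: abs_mult\<close>)
    qed
    moreover have "((\<lambda>t. exp (- \<eta> * t)) \<longlongrightarrow> 0) at_top"
      using \<eta> by real_asymp
    moreover have "((\<lambda>t :: real. exp (- (1/2) * t)) \<longlongrightarrow> 0) at_top"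
      by real_asymp
    ultimately have "((\<lambda>t. \<sigma> * (U t * exp (- (1/2) * t)) - D / \<eta> * (exp (- \<eta> * t) * exp (- (1/2) * t))) \<longlongrightarrow> \<sigma> * 0 - D / \<eta> * (0 * 0)) at_top"
      by (intro tendsto_intros)
    then show "((\<lambda>t. (\<sigma> * U t - D / \<eta> * exp (- \<eta> * t)) * exp (- (1/2) * t)) \<longlongrightarrow> 0) at_top"
      by (simp add: algebra_simps)
  qed
  have "\<bar>U t\<bar> \<le> D / \<eta> * exp (- \<eta> * t)" if "t \<ge> T + 1" for t
    using bound[of 1 t] bound[of "- 1" t] that by auto
  moreover have "T + 1 > 0" using S by (simp add: T_def)
  ultimately show ?thesis using \<eta> by blast
qed

text \<open>Bootstrap: decay of \<open>U\<close> gives convergence of \<open>V\<close> and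
  \<open>F\<close>, and \<open>unstable_limit\<close> then gives that of \<open>P\<close> and next
  of \<open>Q\<close>. The a priori growth bound it needs comes from the explicit factor
  \<open>(cosh t)\<^sup>2\<close>.\<close>

lemma second_derivative_converges:
  assumes above: "\<And>t. t > 0 \<Longrightarrow> p t \<ge> - barrier t"
  shows "\<exists>q. (Q \<longlongrightarrow> q) at_top"
proof -
  obtain \<eta> C S where \<eta>: "0 < \<eta>" and S: "0 < S" and U: "\<And>t. t \<ge> S \<Longrightarrow> \<bar>U t\<bar> \<le> C * exp (- \<eta> * t)"
    using U_exponential_bound[OF above] by blast
  have w: "w t \<le> 30" if "t > 0" for t using w_le_30[OF above] that by simp
  obtain v where v: "(V \<longlongrightarrow> v) at_top"
    using convergent_at_top_exp_deriv[OF \<eta> V_deriv U] S by force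
  have U0: "(U \<longlongrightarrow> 0) at_top"
  proof (rule Lim_null_comparison)
    show "((\<lambda>t. C * exp (- \<eta> * t)) \<longlongrightarrow> 0) at_top" using \<eta> by real_asymp
    show "\<forall>\<^sub>F t in at_top. norm (U t) \<le> C * exp (- \<eta> * t)"
      using eventually_ge_at_top[of S] by eventually_elim (use U in auto)
  qed
  have F: "(F \<longlongrightarrow> 2 * (m + 1) * (1 - exp v)) at_top"
    unfolding F_def by (intro tendsto_intros v)
  have "((\<lambda>t. U t * ((cosh t)\<^sup>2 * exp (- (5/2) * t))) \<longlongrightarrow> 0 * 0) at_top"
    by (intro tendsto_mult U0 cosh_square_exp_tendsto_0)
  then have "((\<lambda>t. P t * exp (- (5/2) * t)) \<longlongrightarrow> 0) at_top"
    by (simp add: P_def mult_ac)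
  then have "(P \<longlongrightarrow> - (2 * (m + 1) * (1 - exp v)) / (m + 2)) at_top"
    using m by (intro unstable_limit[where \<gamma> = "5/2", OF _ _ P_deriv F] w) auto
  then obtain p1 where P: "(P \<longlongrightarrow> p1) at_top" by blast
  have "((\<lambda>t. ((m + 2) - 2 * (m + 1) * exp (V t)) * P t) \<longlongrightarrow> ((m + 2) - 2 * (m + 1) * exp v) * p1) at_top"
    by (intro tendsto_intros v P)
  moreover have "((\<lambda>t. ((m + 2) * tanh t * P t + F t) * ((cosh t)\<^sup>2 * exp (- (5/2) * t))) \<longlongrightarrow>
      ((m + 2) * 1 * p1 + 2 * (m + 1) * (1 - exp v)) * 0) at_top"
    by (intro tendsto_intros P F tanh_real_at_top cosh_square_exp_tendsto_0)
  then have "((\<lambda>t. Q t * exp (- (5/2) * t)) \<longlongrightarrow> 0) at_top"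
    by (simp add: Q_def mult_ac)
  ultimately have "(Q \<longlongrightarrow> - (((m + 2) - 2 * (m + 1) * exp v) * p1) / (m + 4)) at_top"
    using m by (intro unstable_limit[where \<gamma> = "5/2", OF _ _ Q_deriv] w) auto
  then show ?thesis by blast
qed

text \<open>Regularity at the poles is obtained by construction: the second derivative is extended
  continuously to the line and integrated twice. Agreement with \<open>V\<close> along
  \<open>z = tanh t\<close> is checked by differentiating in \<open>t\<close>; the equation reaches
  \<open>z = 1\<close> by continuity and negative \<open>z\<close> by evenness.\<close>

lemma profile_exists:
  assumes above: "\<And>t. t > 0 \<Longrightarrow> p t \<ge> - barrier t"
  shows "\<exists>G G1 G2. (\<forall>z. (G has_real_derivative G1 z) (at z)) \<and>
    (\<forall>z. (G1 has_real_derivative G2 z) (at z)) \<and> continuous_on UNIV G2 \<and>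
    G 0 = a + ln (m / (m + 1)) \<and>
    (\<forall>z. \<bar>z\<bar> \<le> 1 \<longrightarrow> (1 - z\<^sup>2) * G2 z - (m + 2) * z * G1 z + 2 * (m + 1) * (exp (G z) - 1) = 0)"
proof -
  have w: "w t \<le> 30" if "t > 0" for t using w_le_30[OF above] that by simp
  obtain q where q: "(Q \<longlongrightarrow> q) at_top" using second_derivative_converges[OF above] by blast
  \<comment> \<open>The second derivative of \<open>V\<close> as a function of
    \<open>cos \<theta>\<close> on the northern side, continued past the pole by its limit
    \<open>q\<close>.\<close>
  define h where "h y = (if y < 1 then Q (artanh y) else q)" for y
  have h_tanh: "h (tanh t) = Q t" for t
    by (simp add: h_def tanh_real_lt_1 artanh_tanh_real)
  have ex_tanh: "\<exists>t\<ge>0. z = tanh t" if "0 \<le> z" "z < 1" for z :: real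
  proof -
    have "\<forall>\<^sub>F t in at_top. z < tanh (t :: real) \<and> t \<ge> 0"
      using order_tendstoD(1)[OF tanh_real_at_top that(2)] eventually_ge_at_top[of 0]
      by eventually_elim simp
    then obtain t :: real where t: "z < tanh t" "t \<ge> 0"
      by (auto dest!: eventually_happens)
    have "\<exists>s. 0 \<le> s \<and> s \<le> t \<and> tanh s = z"
      using t that by (intro IVT' continuous_intros) auto
    then show ?thesis by auto
  qed
  have h_cont: "continuous_on {0..} h"
    unfolding continuous_on_eq_continuous_within
  proof
    fix y :: real assume y: "y \<in> {0..}"
    consider "y < 1" | "y = 1" | "y > 1" by linarith
    then show "continuous (at y within {0..}) h"
    proof cases
      case 1
      have "continuous_on {0..<1} (\<lambda>y. Q (artanh y))"
      proof (rule continuous_on_compose2[OF Q_cont])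
        show "artanh ` {0..<1 :: real} \<subseteq> {0..}"
          using ex_tanh by (force simp: artanh_tanh_real)
      qed (intro continuous_intros; auto)
      then have "continuous_on {0..<1} h"
        by (rule continuous_on_eq) (simp add: h_def)
      then have "continuous (at y within {0..<1}) h"
        using 1 y by (simp add: continuous_on_eq_continuous_within)
      moreover have "at y within {0..<1} = at y within {0..}"
        using 1 by (intro at_within_nhd[of _ "{..<1}"]) auto
      ultimately show ?thesis by simp
    next
      case 2
      have "(h \<longlongrightarrow> q) (at 1)"
      proof (rule tendstoI)
        fix e :: real assume e: "e > 0"
        obtain S where S: "\<And>t. t \<ge> S \<Longrightarrow> dist (Q t) q < e"
          using tendstoD[OF q e] unfolding eventually_at_top_linorder by blast
        have "dist (h y) q < e" if y: "y > max 0 (tanh S)" for y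
        proof (cases "y < 1")
          case True
          then obtain t where t: "y = tanh t" using ex_tanh[of y] y by auto
          then show ?thesis using y S[of t] by (simp add: h_tanh)
        qed (use e in \<open>simp add: h_def\<close>)
        moreover have "\<forall>\<^sub>F y in at 1. y > max 0 (tanh S)"
          using tanh_real_lt_1[of S] by (intro order_tendstoD(1)[OF tendsto_ident_at]) simp
        ultimately show "\<forall>\<^sub>F y in at 1. dist (h y) q < e"
          by (auto elim: eventually_mono)
      qed
      then have "isCont h 1" by (simp add: isCont_def h_def)
      then show ?thesis using 2 continuous_at_imp_continuous_at_within by blast
    next
      case 3
      have "isCont h y"
      proof (subst isCont_cong)
        show "\<forall>\<^sub>F x in nhds y. h x = q"
          using eventually_nhds_in_open[of "{1<..}" y] 3 by (auto simp: h_def elim: eventually_mono)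
      qed simp
      then show ?thesis using continuous_at_imp_continuous_at_within by blast
    qed
  qed
  \<comment> \<open>The even extension covers the southern hemisphere. Together with
    \<open>G1 0 = 0\<close>, which matches \<open>P 0 = 0\<close> because \<open>p 0 = 0\<close>, it
    makes \<open>G1\<close> odd and \<open>G\<close> even.\<close>
  define G2 where "G2 z = h \<bar>z\<bar>" for z
  have G2_cont: "continuous_on UNIV G2"
    unfolding G2_def by (intro continuous_on_compose2[OF h_cont] continuous_intros) auto
  have antideriv: "\<exists>A. A 0 = c \<and> (\<forall>z. (A has_real_derivative f z) (at z))"
    if "continuous_on UNIV f" for f :: "real \<Rightarrow> real" and c
  proof -
    have "\<exists>A. \<forall>x. - \<infinity> < ereal x \<longrightarrow> ereal x < \<infinity> \<longrightarrow> (A has_vector_derivative f x) (at x)"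
      using that by (intro einterval_antiderivative) (auto simp: continuous_on_eq_continuous_at)
    then obtain A where A: "\<And>z. (A has_real_derivative f z) (at z)"
      by (auto simp: has_real_derivative_iff_has_vector_derivative)
    have "((\<lambda>z. A z + (c - A 0)) has_real_derivative f z) (at z)" for z
      using A by (auto intro!: derivative_eq_intros)
    then show ?thesis by (intro exI[of _ "\<lambda>z. A z + (c - A 0)"]) auto
  qed
  obtain G1 where G1: "G1 0 = 0" "\<And>z. (G1 has_real_derivative G2 z) (at z)"
    using antideriv[OF G2_cont] by blast
  have G1_cont: "continuous_on UNIV G1" using G1(2) DERIV_continuous_on[of UNIV G1 G2] by simp
  obtain G where G: "G 0 = V 0" "\<And>z. (G has_real_derivative G1 z) (at z)"
    using antideriv[OF G1_cont] by blast
  have G_cont: "continuous_on UNIV G" using G(2) DERIV_continuous_on[of UNIV G G1] by simp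
  have along: "A (tanh t) = B t"
    if A: "\<And>z. (A has_real_derivative A' z) (at z)" and B: "continuous_on {0..} B"
      "\<And>t. t > 0 \<Longrightarrow> (B has_real_derivative A' (tanh t) * (1 - (tanh t)\<^sup>2)) (at t)"
      and "A 0 = B 0" and t: "t \<ge> 0" for A A' B t
  proof (cases "t = 0")
    case False
    have A_cont: "continuous_on UNIV A" using A DERIV_continuous_on[of UNIV A A'] by simp
    have "A (tanh t) - B t = A (tanh 0) - B 0"
    proof (rule DERIV_isconst2[where f = "\<lambda>t. A (tanh t) - B t" and b = t])
      show "continuous_on {0..t} (\<lambda>t. A (tanh t) - B t)"
        by (intro continuous_intros continuous_on_compose2[OF A_cont] continuous_on_subset[OF B(1)]) auto
      fix s assume s: "0 < s" "s < t"
      have "((\<lambda>t. A (tanh t)) has_real_derivative A' (tanh s) * (1 - (tanh s)\<^sup>2)) (at s)"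
        by (rule DERIV_chain2[OF A]) (auto intro!: derivative_eq_intros)
      from DERIV_diff[OF this B(2)[OF s(1)]]
      show "((\<lambda>t. A (tanh t) - B t) has_real_derivative 0) (at s)" by simp
    qed (use t False in auto)
    then show ?thesis using that by simp
  qed (use that in simp)
  have P_deriv': "(P has_real_derivative G2 (tanh t) * (1 - (tanh t)\<^sup>2)) (at t)" if t: "t > 0" for t
  proof -
    have "G2 (tanh t) * (1 - (tanh t)\<^sup>2) = (m + 2) * tanh t * P t + F t"
      using t by (simp add: G2_def h_tanh Q_def sech_square)
    then show ?thesis using P_deriv[OF t w[OF t]] by simp
  qed
  have P0: "P 0 = 0" by (simp add: P_def U_def p0)
  have G1_tanh: "G1 (tanh t) = P t" if "t \<ge> 0" for t
    by (rule along[OF G1(2) P_cont P_deriv' _ that]) (simp_all add: G1 P0)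
  have V_deriv': "(V has_real_derivative G1 (tanh t) * (1 - (tanh t)\<^sup>2)) (at t)" if t: "t > 0" for t
  proof -
    have "G1 (tanh t) * (1 - (tanh t)\<^sup>2) = U t"
      using t by (simp add: G1_tanh P_def sech_square)
    then show ?thesis using V_deriv[OF t] by simp
  qed
  have G_tanh: "G (tanh t) = V t" if "t \<ge> 0" for t
    by (rule along[OF G(2) V_cont V_deriv' _ that]) (simp_all add: G)
  define Z where "Z z = (1 - z\<^sup>2) * G2 z - (m + 2) * z * G1 z + 2 * (m + 1) * (exp (G z) - 1)" for z
  have Z_cont: "continuous_on A Z" for A
    unfolding Z_def
    by (intro continuous_intros continuous_on_subset[OF G2_cont] continuous_on_subset[OF G1_cont]
        continuous_on_subset[OF G_cont]) auto
  have Z_open: "Z z = 0" if z: "z \<in> {0..<1}" for z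
  proof -
    obtain t where t: "t \<ge> 0" "z = tanh t" using ex_tanh z by auto
    have "(1 - z\<^sup>2) * G2 z = (m + 2) * z * P t + F t"
      using t by (simp add: G2_def h_tanh Q_def sech_square)
    then show ?thesis using t by (simp add: Z_def G1_tanh G_tanh F_def algebra_simps)
  qed
  have Z_closed: "Z z = 0" if "0 \<le> z" "z \<le> 1" for z
    by (rule continuous_constant_on_closure[of "{0..<1}", OF Z_cont Z_open]) (use that in auto)
  have G1_odd: "G1 (- z) = - G1 z" for z
  proof -
    have "((\<lambda>z. G1 z + G1 (- z)) has_real_derivative G2 z + G2 (- z) * (- 1)) (at z)" for z
      by (auto intro!: derivative_eq_intros G1 DERIV_chain2[OF G1(2)])
    then have "\<forall>z. ((\<lambda>z. G1 z + G1 (- z)) has_real_derivative 0) (at z)"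
      by (simp add: G2_def)
    from DERIV_isconst_all[OF this, of z 0] show ?thesis by (simp add: G1)
  qed
  have G_even: "G (- z) = G z" for z
  proof -
    have "((\<lambda>z. G z - G (- z)) has_real_derivative G1 z - G1 (- z) * (- 1)) (at z)" for z
      by (auto intro!: derivative_eq_intros G DERIV_chain2[OF G(2)])
    then have "\<forall>z. ((\<lambda>z. G z - G (- z)) has_real_derivative 0) (at z)"
      by (simp add: G1_odd)
    from DERIV_isconst_all[OF this, of z 0] show ?thesis by simp
  qed
  have "Z z = 0" if "\<bar>z\<bar> \<le> 1" for z
  proof (cases "z \<ge> 0")
    case False
    then have "Z (- z) = 0" using that by (intro Z_closed) auto
    then show ?thesis by (simp add: Z_def G1_odd G_even G2_def)
  qed (use that Z_closed in auto)
  moreover have "G 0 = a + ln (m / (m + 1))" by (simp add: G V_def w0)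
  ultimately show ?thesis
    using G(2) G1(2) G2_cont unfolding Z_def
    by (intro exI[of _ G] exI[of _ G1] exI[of _ G2]) simp
qed

end

section \<open>Existence of regular orbits\<close>

context shooting_orbit
begin

lemma norm_ge:
  assumes t: "t \<ge> 0"
  shows "exp (- shooting_lip * t) * a \<le> norm (w t, p t)"
proof -
  have "exp (- shooting_lip * t) * norm (w 0, p 0) \<le> norm (w t, p t)"
  proof (rule lipschitz_growth_bounds(2)[OF _ field_derivative _ t])
    show "continuous_on {0..} (\<lambda>t. (w t, p t))"
      by (intro continuous_intros w_cont p_cont)
    show "norm (shooting_field m t (w t, p t)) \<le> shooting_lip * norm (w t, p t)" for t
      using shooting_field_lipschitz[OF m, of t "(w t, p t)" 0]
      by (simp add: shooting_field_def trunc_exp_eq)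
  qed
  then show ?thesis using a by (simp add: w0 p0)
qed

text \<open>A small start keeps \<open>\<bar>w\<bar> \<le> 1/15\<close> up to time \<open>T\<close>,
  so \<open>angle_rate\<close> applies throughout. This makes the winding unbounded as
  \<open>a\<close> tends to 0.\<close>

lemma angle_le_of_small_start:
  assumes T: "T \<ge> 0" and small: "exp (shooting_lip * T) * a \<le> 1/15"
  shows "\<phi> T \<le> - T / 50"
proof -
  have "- (\<phi> 0 + 1/50 * 0) \<le> - (\<phi> T + 1/50 * T)"
  proof (rule DERIV_nonneg_imp_increasing_open[where f = "\<lambda>t. - (\<phi> t + 1/50 * t)", OF T])
    show "continuous_on {0..T} (\<lambda>t. - (\<phi> t + 1/50 * t))"
      by (intro continuous_intros continuous_on_subset[OF \<phi>_cont]) auto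
    fix t assume t: "0 < t" "t < T"
    have "shooting_lip * t \<le> shooting_lip * T"
      using t by (intro mult_left_mono) (auto simp: shooting_lip_def)
    then have "exp (shooting_lip * t) * a \<le> exp (shooting_lip * T) * a"
      using a by (intro mult_right_mono) auto
    then have "\<bar>w t\<bar> \<le> 1/15"
      using norm_le[of t] norm_fst_le[of "w t" "p t"] small t by simp
    then obtain d where d: "d \<le> - 1/50" "(\<phi> has_real_derivative d) (at t)"
      using angle_rate[OF t(1)] by fastforce
    show "\<exists>y. ((\<lambda>t. - (\<phi> t + 1/50 * t)) has_real_derivative y) (at t) \<and> 0 \<le> y"
      using d by (intro exI[of _ "- (d + 1/50)"]) (auto intro!: derivative_eq_intros)
  qed
  then show ?thesis by (simp add: \<phi>0)
qed

end

text \<open>Closeness makes the inner product of the two phase points positive, so the difference of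
  the lifted angles, which starts at 0, can never reach \<open>pi / 2\<close> in absolute value.
  This compares full winding, not just directions.\<close>

lemma angle_dist:
  assumes x: "shooting_orbit m a w p \<phi>" and y: "shooting_orbit m b v q \<psi>" and s: "s \<ge> 0"
    and close: "\<And>t. 0 \<le> t \<Longrightarrow> t \<le> s \<Longrightarrow> norm ((w t, p t) - (v t, q t)) < norm (w t, p t)"
  shows "\<bar>\<phi> s - \<psi> s\<bar> < pi / 2"
proof -
  interpret x: shooting_orbit m a w p \<phi> by fact
  interpret y: shooting_orbit m b v q \<psi> by fact
  have cos_pos: "cos (\<phi> t - \<psi> t) > 0" if t: "0 \<le> t" "t \<le> s" for t
  proof -
    define r where "r = sqrt ((w t)\<^sup>2 + (p t)\<^sup>2)"
    define \<rho> where "\<rho> = sqrt ((v t)\<^sup>2 + (q t)\<^sup>2)"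
    have pos: "r > 0" "\<rho> > 0"
      using x.R_pos[OF t(1)] y.R_pos[OF t(1)] by (simp_all add: r_def \<rho>_def)
    have eq: "w t = r * cos (\<phi> t)" "p t = r * sin (\<phi> t)" "v t = \<rho> * cos (\<psi> t)" "q t = \<rho> * sin (\<psi> t)"
      using x.w_polar[OF t(1)] x.p_polar[OF t(1)] y.w_polar[OF t(1)] y.p_polar[OF t(1)]
      by (simp_all add: r_def \<rho>_def)
    have "(norm ((w t, p t) - (v t, q t)))\<^sup>2 < (norm (w t, p t))\<^sup>2"
      using close[OF t] by (intro power_strict_mono) auto
    then have "(w t - v t)\<^sup>2 + (p t - q t)\<^sup>2 < (w t)\<^sup>2 + (p t)\<^sup>2"
      by (simp add: norm_Pair)
    then have "(v t)\<^sup>2 + (q t)\<^sup>2 < 2 * (w t * v t + p t * q t)"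
      by (simp add: power2_eq_square algebra_simps)
    then have "0 < 2 * (w t * v t + p t * q t)" using y.R_pos[OF t(1)] by (rule less_trans[rotated])
    then have "0 < w t * v t + p t * q t" by simp
    also have "w t * v t + p t * q t = (r * \<rho>) * cos (\<phi> t - \<psi> t)"
      unfolding eq cos_diff by (simp add: algebra_simps)
    finally show ?thesis using zero_less_mult_pos mult_pos_pos[OF pos] by blast
  qed
  define d where "d t = \<phi> t - \<psi> t" for t
  have d_cont: "continuous_on {0..s} d"
    unfolding d_def
    by (intro continuous_intros continuous_on_subset[OF x.\<phi>_cont] continuous_on_subset[OF y.\<phi>_cont]) auto
  have d0: "d 0 = 0" by (simp add: d_def x.\<phi>0 y.\<phi>0)
  have not_half: "d t \<noteq> pi / 2" "d t \<noteq> - (pi / 2)" if "0 \<le> t" "t \<le> s" for t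
    using cos_pos[OF that, folded d_def] cos_pi_half cos_minus[of "pi / 2"] by (metis less_irrefl)+
  have "d s < pi / 2"
  proof (rule ccontr)
    assume "\<not> d s < pi / 2"
    then have "\<exists>t. 0 \<le> t \<and> t \<le> s \<and> d t = pi / 2"
      using d0 s by (intro IVT' d_cont) auto
    then show False using not_half by blast
  qed
  moreover have "d s > - (pi / 2)"
  proof (rule ccontr)
    assume "\<not> d s > - (pi / 2)"
    then have "\<exists>t. 0 \<le> t \<and> t \<le> s \<and> d t = - (pi / 2)"
      using d0 s by (intro IVT2' d_cont) auto
    then show False using not_half by blast
  qed
  ultimately show ?thesis unfolding d_def[symmetric] by linarith
qed

text \<open>
  If every orbit with small initial height fell below the barrier, then the winding number at which
  it does so would be locally constant in the height; but orbits starting low wind arbitrarily often.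
\<close>

lemma orbit_above_barrier_exists:
  assumes m: "1 \<le> m" "m \<le> 7" and \<epsilon>: "\<epsilon> > 0"
  shows "\<exists>a w p \<phi>. a < \<epsilon> \<and> shooting_orbit m a w p \<phi> \<and> (\<forall>t>0. p t \<ge> - shooting_orbit.barrier m t)"
proof (rule ccontr)
  assume none: "\<not> ?thesis"
  obtain w p \<phi> where orbit: "\<And>a. a > 0 \<Longrightarrow> shooting_orbit m a (w a) (p a) (\<phi> a)"
    using shooting_orbit_exists[OF m] by metis
  define settles where
    "settles a k \<longleftrightarrow> (\<exists>s>0. p a s < - shooting_orbit.barrier m s \<and> \<phi> a s \<in> falling_window k)" for a k
  define A where "A = {0<..<\<epsilon>}"
  have settles_ex: "\<exists>k. settles a k" if aA: "a \<in> A" for a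
  proof -
    interpret shooting_orbit m a "w a" "p a" "\<phi> a" using orbit aA by (simp add: A_def)
    have "\<not> (\<forall>t>0. p a t \<ge> - barrier t)"
    proof
      assume "\<forall>t>0. p a t \<ge> - barrier t"
      moreover have "a < \<epsilon>" using aA by (simp add: A_def)
      ultimately show False using none shooting_orbit_axioms by blast
    qed
    then obtain s where "s > 0" "p a s < - barrier s" by (auto simp: not_le)
    then show ?thesis unfolding settles_def using below_barrier_window by blast
  qed
  have settles_unique: "k = j" if aA: "a \<in> A" and k: "settles a k" and j: "settles a j" for a k j
  proof -
    interpret shooting_orbit m a "w a" "p a" "\<phi> a" using orbit aA by (simp add: A_def)
    obtain s r where s: "s > 0" "p a s < - barrier s" "\<phi> a s \<in> falling_window k"
      and r: "r > 0" "p a r < - barrier r" "\<phi> a r \<in> falling_window j"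
      using k j unfolding settles_def by blast
    show ?thesis
      using falling_window_stays[OF s, of "max s r"] falling_window_stays[OF r, of "max s r"]
        falling_window_unique by simp
  qed
  define K where "K a = (SOME k. settles a k)" for a
  have K: "settles a (K a)" if "a \<in> A" for a
    unfolding K_def using settles_ex[OF that] by (rule someI_ex)
  define L where "L = shooting_lip"
  have L: "L > 0" by (simp add: L_def shooting_lip_def add_pos_pos)
  have "\<forall>\<^sub>F b in at a within A. K a = K b" if a: "a \<in> A" for a
  proof -
    interpret x: shooting_orbit m a "w a" "p a" "\<phi> a" using orbit a by (simp add: A_def)
    obtain s where s: "s > 0" "p a s < - x.barrier s" "\<phi> a s \<in> falling_window (K a)"
      using K[OF a] unfolding settles_def by blast
    have ws: "w a s < 0"
      using x.angle_signs(2)[of s] falling_window_signs[OF s(3)] s(1) by simp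
    \<comment> \<open>The first entry feeds \<open>angle_dist\<close> through
      \<open>norm_ge\<close>; the other two keep the perturbed orbit below the barrier and in
      \<open>w < 0\<close> at time \<open>s\<close>.\<close>
    define \<delta> where "\<delta> = min (exp (- L * s) * a) (min (- x.barrier s - p a s) (- w a s))"
    have \<delta>: "\<delta> > 0" using s ws x.a by (simp add: \<delta>_def)
    have "K a = K b" if b: "b \<in> A" and dist: "\<bar>a - b\<bar> < exp (- L * s) * \<delta>" for b
    proof -
      interpret y: shooting_orbit m b "w b" "p b" "\<phi> b" using orbit b by (simp add: A_def)
      have diff: "norm ((w a t, p a t) - (w b t, p b t)) < \<delta>" if t: "0 \<le> t" "t \<le> s" for t
      proof -
        have "norm ((w a t, p a t) - (w b t, p b t)) \<le> exp (L * t) * \<bar>a - b\<bar>"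
          unfolding L_def by (rule shooting_orbit_dist[OF x.shooting_orbit_axioms y.shooting_orbit_axioms t(1)])
        also have "\<dots> \<le> exp (L * s) * \<bar>a - b\<bar>"
          using t L by (intro mult_right_mono) auto
        also have "\<dots> < exp (L * s) * (exp (- L * s) * \<delta>)"
          using dist by (intro mult_strict_left_mono) auto
        also have "\<dots> = \<delta>" by (simp add: exp_minus)
        finally show ?thesis .
      qed
      have close: "\<bar>\<phi> a s - \<phi> b s\<bar> < pi / 2"
      proof (rule angle_dist[OF x.shooting_orbit_axioms y.shooting_orbit_axioms])
        fix t assume t: "0 \<le> t" "t \<le> s"
        have "\<delta> \<le> exp (- L * s) * a" by (simp add: \<delta>_def)
        also have "\<dots> \<le> exp (- L * t) * a"
          using t L x.a by (intro mult_right_mono) auto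
        also have "\<dots> \<le> norm (w a t, p a t)" unfolding L_def by (rule x.norm_ge[OF t(1)])
        finally show "norm ((w a t, p a t) - (w b t, p b t)) < norm (w a t, p a t)"
          using diff[OF t] by linarith
      qed (use s in simp)
      have "\<bar>w a s - w b s\<bar> < \<delta>" "\<bar>p a s - p b s\<bar> < \<delta>"
        using diff[of s] s(1) norm_fst_le[of "w a s - w b s" "p a s - p b s"]
          norm_snd_le[of "p a s - p b s" "w a s - w b s"] by auto
      then have wp: "w b s < 0" "p b s < - x.barrier s" by (auto simp: \<delta>_def)
      have "\<phi> b s \<in> falling_window (K a)"
      proof (rule falling_windowI)
        show "cos (\<phi> b s) < 0" "sin (\<phi> b s) < 0"
          using s(1) wp y.angle_signs[of s] x.barrier_ge[of s] by simp_all
        \<comment> \<open>The window widened by a quarter turn on both sides still lies in the full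
          turn of \<open>falling_windowI\<close>.\<close>
        have "of_int (4 * K a - 2) * (pi / 2) = of_int (4 * K a - 3) * (pi / 2) + pi / 2"
          "of_int (4 * K a + 1) * (pi / 2) = of_int (4 * K a - 1) * (pi / 2) + pi"
          by (simp_all add: algebra_simps)
        then show "of_int (4 * K a - 3) * (pi / 2) \<le> \<phi> b s" "\<phi> b s < of_int (4 * K a + 1) * (pi / 2)"
          using close s(3) pi_gt_zero unfolding falling_window_def greaterThanLessThan_iff by linarith+
      qed
      then have "settles b (K a)" using s wp unfolding settles_def by blast
      then show ?thesis using settles_unique[OF b _ K[OF b]] by blast
    qed
    then show ?thesis
      unfolding eventually_at using \<delta>
      by (intro exI[of _ "exp (- L * s) * \<delta>"]) (auto simp: dist_real_def abs_minus_commute)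
  qed
  then have const: "K a = K b" if "a \<in> A" "b \<in> A" for a b
    using that by (intro connected_local_const[of A]) (auto simp: A_def)
  have half: "\<epsilon> / 2 \<in> A" using \<epsilon> by (simp add: A_def)
  \<comment> \<open>The lower end of the window common to all heights. Since
    \<open>- T / 50 < - \<bar>c\<bar>\<close>, a sufficiently low start has already turned past it
    at time \<open>T\<close>, and it cannot be crossed back.\<close>
  define c where "c = of_int (4 * K (\<epsilon> / 2) - 2) * (pi / 2)"
  define T where "T = 50 * \<bar>c\<bar> + 1"
  have T: "T > 0" by (simp add: T_def add_nonneg_pos)
  define a where "a = min (\<epsilon> / 2) (exp (- L * T) * (1/15))"
  have aA: "a \<in> A" using \<epsilon> by (auto simp: a_def A_def min_def)
  interpret shooting_orbit m a "w a" "p a" "\<phi> a" using orbit aA by (simp add: A_def)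
  have "exp (L * T) * a \<le> exp (L * T) * (exp (- L * T) * (1/15))"
    by (intro mult_left_mono) (auto simp: a_def)
  then have "exp (shooting_lip * T) * a \<le> 1/15" by (simp add: L_def exp_minus)
  then have "\<phi> a T \<le> - T / 50" using T by (intro angle_le_of_small_start) auto
  then have start: "\<phi> a T \<le> c" by (simp add: T_def abs_if split: if_splits)
  obtain s where s: "s > 0" "p a s < - barrier s" "\<phi> a s \<in> falling_window (K (\<epsilon> / 2))"
    using K[OF aA] const[OF aA half] unfolding settles_def by auto
  have "\<phi> a (max s T) > c"
    using falling_window_stays[OF s, of "max s T"] by (simp add: falling_window_def c_def)
  moreover have "\<phi> a (max s T) \<le> c"
    unfolding c_def by (rule angle_le[OF T start[unfolded c_def]]) simp
  ultimately show False by simp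
qed

lemma profiles_accumulate:
  assumes m: "1 \<le> m" "m \<le> 7" and \<epsilon>: "\<epsilon> > 0"
  shows "\<exists>a G G1 G2. 0 < a \<and> a < \<epsilon> \<and> (\<forall>z. (G has_real_derivative G1 z) (at z)) \<and>
    (\<forall>z. (G1 has_real_derivative G2 z) (at z)) \<and> continuous_on UNIV G2 \<and>
    G 0 = a + ln (m / (m + 1)) \<and>
    (\<forall>z. \<bar>z\<bar> \<le> 1 \<longrightarrow> (1 - z\<^sup>2) * G2 z - (m + 2) * z * G1 z + 2 * (m + 1) * (exp (G z) - 1) = 0)"
proof -
  obtain a w p \<phi> where less: "a < \<epsilon>" and orbit: "shooting_orbit m a w p \<phi>"
    and above: "\<And>t. t > 0 \<Longrightarrow> p t \<ge> - shooting_orbit.barrier m t"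
    using orbit_above_barrier_exists[OF m \<epsilon>] by blast
  interpret shooting_orbit m a w p \<phi> by fact
  show ?thesis
    using profile_exists[OF above] a less by (intro exI[of _ a]) simp
qed

text \<open>The half circle spanned by \<open>north\<close> and \<open>e\<close> realizes every
  height \<open>z\<close>, so constancy on the sphere would make \<open>G\<close> constant on an
  open interval around 0.\<close>

lemma axial_not_constant_on:
  fixes north e :: "'a::euclidean_space"
  assumes unit: "north \<bullet> north = 1" "e \<bullet> e = 1" "e \<bullet> north = 0"
    and G: "\<And>z. (G has_real_derivative G1 z) (at z)"
    and G1: "\<And>z. (G1 has_real_derivative G2 z) (at z)" and "G2 0 \<noteq> 0"
  shows "\<not> (\<lambda>x. G (x \<bullet> north)) constant_on sphere 0 1"
proof
  assume "(\<lambda>x. G (x \<bullet> north)) constant_on sphere 0 1"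
  then obtain c where c: "\<And>x. x \<in> sphere 0 1 \<Longrightarrow> G (x \<bullet> north) = c"
    unfolding constant_on_def by blast
  have G_const: "G z = c" if z: "\<bar>z\<bar> < 1" for z
  proof -
    define x where "x = z *\<^sub>R north + sqrt (1 - z\<^sup>2) *\<^sub>R e"
    have "1 - z\<^sup>2 \<ge> 0" using z by (simp add: abs_square_le_1)
    then have "x \<bullet> x = 1"
      by (simp add: x_def inner_add_left inner_add_right unit inner_commute[of north e]
          power2_eq_square[symmetric])
    then have "x \<in> sphere 0 1" by (simp add: norm_eq_sqrt_inner)
    moreover have "x \<bullet> north = z" by (simp add: x_def inner_add_left unit)
    ultimately show ?thesis using c by blast
  qed
  have G1_zero: "G1 z = 0" if z: "\<bar>z\<bar> < 1" for z
  proof (rule DERIV_unique[OF G])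
    show "(G has_real_derivative 0) (at z)"
      by (rule has_field_derivative_transform_within_open[of "\<lambda>_. c" _ _ "{-1<..<1}"])
        (use z G_const in \<open>auto simp: abs_less_iff\<close>)
  qed
  have "G2 0 = 0"
  proof (rule DERIV_unique[OF G1])
    show "(G1 has_real_derivative 0) (at 0)"
      by (rule has_field_derivative_transform_within_open[of "\<lambda>_. 0" _ _ "{-1<..<1}"])
        (use G1_zero in \<open>auto simp: abs_less_iff\<close>)
  qed
  then show False using \<open>G2 0 \<noteq> 0\<close> by simp
qed

theorem theorem2:
  fixes N :: nat and north :: "real ^ 'n"
  assumes "CARD('n) = N" and "4 \<le> N" and "N \<le> 10"
    and "north \<in> sphere 0 1"
  shows "\<exists>V :: nat \<Rightarrow> real ^ 'n \<Rightarrow> real.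
           (\<forall>k. classical_solution (V k) \<and> axially_symmetric north (V k) \<and>
                \<not> V k constant_on sphere 0 1) \<and>
           (\<forall>i j. i \<noteq> j \<longrightarrow> (\<exists>x\<in>sphere 0 1. V i x \<noteq> V j x))"
proof -
  define m where "m = real N - 3"
  have m: "1 \<le> m" "m \<le> 7" using assms by (auto simp: m_def)
  define profile where "profile a G \<longleftrightarrow> (\<exists>G1 G2. (\<forall>z. (G has_real_derivative G1 z) (at z)) \<and>
    (\<forall>z. (G1 has_real_derivative G2 z) (at z)) \<and> continuous_on UNIV G2 \<and>
    G 0 = a + ln (m / (m + 1)) \<and>
    (\<forall>z. \<bar>z\<bar> \<le> 1 \<longrightarrow> (1 - z\<^sup>2) * G2 z - (m + 2) * z * G1 z + 2 * (m + 1) * (exp (G z) - 1) = 0))"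
    for a G
  \<comment> \<open>Heights below \<open>ln ((m + 1) / m)\<close> make the solution negative on the equator, hence nonconstant.\<close>
  define A where "A = {a. 0 < a \<and> a < ln ((m + 1) / m) \<and> (\<exists>G. profile a G)}"
  have ex: "\<exists>a\<in>A. a < \<epsilon>" if "\<epsilon> > 0" for \<epsilon>
  proof -
    have "ln ((m + 1) / m) > 0" using m by simp
    then have "\<exists>a G. 0 < a \<and> a < min \<epsilon> (ln ((m + 1) / m)) \<and> profile a G"
      unfolding profile_def using profiles_accumulate[OF m, of "min \<epsilon> (ln ((m + 1) / m))"] that
      by (simp only: min_less_iff_conj) blast
    then show ?thesis by (auto simp: A_def)
  qed
  have "infinite A"
  proof
    assume fin: "finite A"
    have "A \<noteq> {}" using ex[of 1] by auto
    then have "Min A \<in> A" using fin by (rule Min_in[rotated])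
    then obtain b where "b \<in> A" "b < Min A" using ex[of "Min A"] by (auto simp: A_def)
    then show False using fin by (meson Min_le not_le)
  qed
  then obtain \<alpha> :: "nat \<Rightarrow> real" where \<alpha>: "inj \<alpha>" "range \<alpha> \<subseteq> A"
    using infinite_countable_subset by blast
  then have "\<forall>k. \<exists>G. profile (\<alpha> k) G" by (auto simp: A_def)
  then obtain G where G: "\<And>k. profile (\<alpha> k) (G k)" by metis
  define V where "V k x = G k (x \<bullet> north)" for k and x :: "real ^ 'n"
  have unit: "north \<bullet> north = 1" using assms(4) by (simp add: dot_square_norm)
  \<comment> \<open>This provides a unit vector \<open>e\<close> on the equator, used both for
    nonconstancy and to tell the solutions apart.\<close>
  have "2 \<le> DIM(real ^ 'n)" using assms by simp
  then obtain y :: "real ^ 'n" where y: "y \<noteq> 0" "orthogonal north y"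
    using orthogonal_to_vector_exists by blast
  define e where "e = y /\<^sub>R norm y"
  have e: "e \<bullet> e = 1" "e \<bullet> north = 0"
    using y by (simp_all add: e_def orthogonal_def inner_commute dot_square_norm power2_eq_square)
  have "classical_solution (V k) \<and> axially_symmetric north (V k) \<and> \<not> V k constant_on sphere 0 1" for k
  proof -
    obtain G1 G2 where G1: "\<And>z. (G k has_real_derivative G1 z) (at z)"
      and G2: "\<And>z. (G1 has_real_derivative G2 z) (at z)" "continuous_on UNIV G2"
      and G0: "G k 0 = \<alpha> k + ln (m / (m + 1))"
      and ode: "\<And>z. \<bar>z\<bar> \<le> 1 \<Longrightarrow> (1 - z\<^sup>2) * G2 z - (m + 2) * z * G1 z + 2 * (m + 1) * (exp (G k z) - 1) = 0"
      using G[of k] unfolding profile_def by blast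
    have V: "V k = (\<lambda>x. G k (x \<bullet> north))" by (simp add: V_def fun_eq_iff)
    have inner_le: "\<bar>x \<bullet> north\<bar> \<le> 1" if "x \<in> sphere 0 1" for x
      using Cauchy_Schwarz_ineq2[of x north] that assms(4) by simp
    have "C2_on_sphere (V k)"
      unfolding C2_on_sphere_def V using C2_on_axial[OF G1 G2] by (intro exI[of _ UNIV]) auto
    moreover have "laplace_beltrami_sphere (V k) x + 2 * (real CARD('n) - 2) * (exp (V k x) - 1) = 0"
      if x: "x \<in> sphere 0 1" for x
      using ode[OF inner_le[OF x]] assms
      unfolding V laplace_beltrami_sphere_axial[OF assms(4) x G1 G2(1)]
      by (simp add: m_def of_nat_diff)
    moreover have "axially_symmetric north (V k)"
      unfolding axially_symmetric_def sphere_geodesic_dist_def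
    proof (intro exI[of _ "\<lambda>\<theta>. G k (cos \<theta>)"] ballI)
      fix x :: "real ^ 'n" assume "x \<in> sphere 0 1"
      then show "V k x = G k (cos (arccos (north \<bullet> x)))"
        unfolding inner_commute[of north x] by (simp add: V_def cos_arccos_abs inner_le)
    qed
    moreover have "\<not> V k constant_on sphere 0 1"
      unfolding V
    proof (rule axial_not_constant_on[OF unit e G1 G2(1)])
      have "\<alpha> k < ln ((m + 1) / m)" using \<alpha> by (auto simp: A_def)
      \<comment> \<open>At \<open>z = 0\<close> the equation reads
        \<open>G2 0 = - 2 * (m + 1) * (exp (G k 0) - 1)\<close>, so a nonzero equatorial value
        forces curvature.\<close>
      then have "G k 0 < 0" using m by (simp add: G0 ln_div)
      then have "2 * (m + 1) * (exp (G k 0) - 1) < 0" using m by (intro mult_pos_neg) auto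
      then show "G2 0 \<noteq> 0" using ode[of 0] by simp
    qed
    ultimately show ?thesis by (simp add: classical_solution_def)
  qed
  moreover have "\<exists>x\<in>sphere 0 1. V i x \<noteq> V j x" if "i \<noteq> j" for i j
  proof
    show "e \<in> sphere 0 1" using e by (simp add: norm_eq_sqrt_inner)
    have "G k 0 = \<alpha> k + ln (m / (m + 1))" for k using G[of k] unfolding profile_def by blast
    then show "V i e \<noteq> V j e"
      using that \<alpha>(1) by (simp add: V_def e inj_eq)
  qed
  ultimately show ?thesis by blast
qed

end
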